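(* Let $\alpha>0$, $N>s>2$, and let $b$ be a bell function as described in the context, which in addition satisfies $|V_bb(z)|\le C\langle z\rangle^{-N}$ for all $z\in\mathbb{R}^2$. Let $\psi_{k,l}(t)=\sqrt{2/\alpha}\,b(t-\alpha k)\sin\!\big(\tfrac{(2l+1)\pi}{2\alpha}(t-\alpha k)\big)$, $k\in\mathbb{Z}$, $l\in\mathbb{N}\cup\{0\}$. If $\sigma\in M^{\infty,\infty}_{1\otimes\langle\cdot\rangle^s}(\mathbb{R}^2)$, then there is a constant $C_s$ such that for all $k,k'\in\mathbb{Z}$, $l,l'\in\mathbb{N}\cup\{0\}$, $$|\langle\sigma^w\psi_{k',l'},\psi_{k,l}\rangle|\le C_s\Big(\big\langle\big(\alpha(k-k'),\tfrac1{2\alpha}(l-l')\big)\big\rangle^{-s}+\big\langle\big(\alpha(k-k'),\tfrac1{2\alpha}(l+l')\big)\big\rangle^{-s}\Big).$$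
   Context: $\langle z\rangle=(1+|z|^2)^{1/2}$. Bell function: take $\epsilon\in(0,\alpha/2)$ and a real, even $\zeta\in C^{N-1}(\mathbb{R})$ supported in $[-\epsilon,\epsilon]$ with $\int\zeta=\pi/2$; set $\theta(t)=\int_{-\infty}^t\zeta(u)du$ and $b(t)=\sin(\theta(t))\cos(\theta(t-\alpha))$. Then $b$ is real, compactly supported, in $C^N(\mathbb{R})$, and $\{\psi_{k,l}\}$ is an orthonormal basis of $L^2(\mathbb{R})$. $\pi(x,\xi)f(t)=e^{2\pi i\xi t}f(t-x)$, $V_bf(z)=\langle f,\pi(z)b\rangle$. Weyl transform $\langle\sigma^wf,h\rangle=\langle\sigma,W(h,f)\rangle$ with $W(f,h)(x,\xi)=\int f(x+t/2)\overline{h(x-t/2)}e^{-2\pi it\xi}dt$. $M^{\infty,\infty}_{1\otimes\langle\cdot\rangle^s}(\mathbb{R}^2)$: $\sigma\in\mathcal S'(\mathbb{R}^2)$ with $\sup_{z,\zeta\in\mathbb{R}^2}|\langle\sigma,\pi(z,\zeta)\Phi\rangle|\langle\zeta\rangle^s<\infty$, $\Phi$ the Gaussian on $\mathbb{R}^2$. *)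

theory Defs
  imports "HOL-Analysis.Analysis"
begin

definition jb :: "'a::real_normed_vector \<Rightarrow> real" where
  "jb z = sqrt (1 + (norm z)^2)"

definition Ck :: "nat \<Rightarrow> (real \<Rightarrow> real) \<Rightarrow> bool" where
  "Ck k f \<longleftrightarrow> (\<forall>j<k. \<forall>x. ((deriv ^^ j) f) differentiable (at x))
              \<and> continuous_on UNIV ((deriv ^^ k) f)"

definition theta :: "(real \<Rightarrow> real) \<Rightarrow> real \<Rightarrow> real" where
  "theta zeta t = integral {..t} zeta"

definition bell :: "real \<Rightarrow> (real \<Rightarrow> real) \<Rightarrow> real \<Rightarrow> real" where
  "bell alpha zeta t = sin (theta zeta t) * cos (theta zeta (t - alpha))"

definition psi :: "real \<Rightarrow> (real \<Rightarrow> real) \<Rightarrow> int \<Rightarrow> nat \<Rightarrow> real \<Rightarrow> complex" where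
  "psi alpha zeta k l t = complex_of_real
     (sqrt (2 / alpha) * bell alpha zeta (t - alpha * of_int k)
        * sin ((2 * real l + 1) * pi / (2 * alpha) * (t - alpha * of_int k)))"

definition tfshift1 :: "real \<times> real \<Rightarrow> (real \<Rightarrow> complex) \<Rightarrow> real \<Rightarrow> complex" where
  "tfshift1 z f t = exp (2 * pi * \<i> * complex_of_real (snd z * t)) * f (t - fst z)"

definition stft1 :: "(real \<Rightarrow> complex) \<Rightarrow> (real \<Rightarrow> complex) \<Rightarrow> real \<times> real \<Rightarrow> complex" where
  "stft1 g f z = (LINT t|lborel. f t * cnj (tfshift1 z g t))"

definition wigner :: "(real \<Rightarrow> complex) \<Rightarrow> (real \<Rightarrow> complex) \<Rightarrow> real \<times> real \<Rightarrow> complex" where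
  "wigner f h z = (LINT t|lborel. f (fst z + t / 2) * cnj (h (fst z - t / 2))
                       * exp (- 2 * pi * \<i> * complex_of_real (t * snd z)))"

definition tfshift2 :: "(real \<times> real) \<times> (real \<times> real) \<Rightarrow> (real \<times> real \<Rightarrow> complex)
                        \<Rightarrow> real \<times> real \<Rightarrow> complex" where
  "tfshift2 Z F w = exp (2 * pi * \<i> * complex_of_real (inner (snd Z) w)) * F (w - fst Z)"

text \<open>L^2-normalised Gaussian on R^2\<close>
definition gauss2 :: "real \<times> real \<Rightarrow> complex" where
  "gauss2 w = complex_of_real (sqrt 2 * exp (- pi * (norm w)^2))"

definition stft2 :: "(real \<times> real \<Rightarrow> complex) \<Rightarrow> (real \<times> real) \<times> (real \<times> real) \<Rightarrow> complex" where
  "stft2 F Z = (LINT w|lborel. F w * cnj (tfshift2 Z gauss2 w))"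

definition pd1 :: "(real \<times> real \<Rightarrow> complex) \<Rightarrow> real \<times> real \<Rightarrow> complex" where
  "pd1 f p = vector_derivative (\<lambda>t. f (t, snd p)) (at (fst p))"

definition pd2 :: "(real \<times> real \<Rightarrow> complex) \<Rightarrow> real \<times> real \<Rightarrow> complex" where
  "pd2 f p = vector_derivative (\<lambda>t. f (fst p, t)) (at (snd p))"

fun dpart :: "bool list \<Rightarrow> (real \<times> real \<Rightarrow> complex) \<Rightarrow> real \<times> real \<Rightarrow> complex" where
  "dpart [] f = f"
| "dpart (d # ds) f = (if d then pd1 (dpart ds f) else pd2 (dpart ds f))"

definition seminorm_S :: "nat \<Rightarrow> nat \<Rightarrow> bool list \<Rightarrow> (real \<times> real \<Rightarrow> complex) \<Rightarrow> real" where
  "seminorm_S a b ds f = (SUP p. \<bar>fst p\<bar> ^ a * \<bar>snd p\<bar> ^ b * cmod (dpart ds f p))"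

definition schwartz2 :: "(real \<times> real \<Rightarrow> complex) set" where
  "schwartz2 = {f. \<forall>ds. continuous_on UNIV (dpart ds f)
      \<and> (\<forall>p. (\<lambda>t. dpart ds f (t, snd p)) differentiable (at (fst p))
           \<and> (\<lambda>t. dpart ds f (fst p, t)) differentiable (at (snd p)))
      \<and> (\<forall>a b. bounded (range (\<lambda>p. \<bar>fst p\<bar> ^ a * \<bar>snd p\<bar> ^ b * cmod (dpart ds f p))))}"

text \<open>A tempered distribution: a linear functional on the Schwartz space, continuous for the
  Schwartz seminorms.  The (sesquilinear) bracket is <sigma, phi> = T (conj phi).\<close>
definition tempered :: "((real \<times> real \<Rightarrow> complex) \<Rightarrow> complex) \<Rightarrow> bool" where
  "tempered T \<longleftrightarrow>
     (\<forall>f\<in>schwartz2. \<forall>g\<in>schwartz2. T (\<lambda>p. f p + g p) = T f + T g)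
   \<and> (\<forall>f\<in>schwartz2. \<forall>c. T (\<lambda>p. c * f p) = c * T f)
   \<and> (\<exists>C n. \<forall>f\<in>schwartz2. cmod (T f) \<le> C * (\<Sum>a\<le>n. \<Sum>b\<le>n. \<Sum>ds\<in>{ds. length ds \<le> n}.
                                                seminorm_S a b ds f))"

definition dstft :: "((real \<times> real \<Rightarrow> complex) \<Rightarrow> complex) \<Rightarrow> (real \<times> real) \<times> (real \<times> real) \<Rightarrow> complex" where
  "dstft T Z = T (\<lambda>w. cnj (tfshift2 Z gauss2 w))"

definition in_Minf_weighted :: "real \<Rightarrow> ((real \<times> real \<Rightarrow> complex) \<Rightarrow> complex) \<Rightarrow> bool" where
  "in_Minf_weighted s T \<longleftrightarrow> tempered T \<and>
     (\<exists>A. \<forall>z zeta. cmod (dstft T (z, zeta)) * jb zeta powr s \<le> A)"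

text \<open>Extension of the duality bracket <sigma, F> (M^{infty,infty} vs M^{1,1}) via the STFT
  with the normalised Gaussian window: <sigma,F> = int V_Phi sigma * conj (V_Phi F).\<close>
definition dpair :: "((real \<times> real \<Rightarrow> complex) \<Rightarrow> complex) \<Rightarrow> (real \<times> real \<Rightarrow> complex) \<Rightarrow> complex" where
  "dpair T F = (LINT Z|lborel. dstft T Z * cnj (stft2 F Z))"

text \<open><sigma^w f, h> = <sigma, W(h,f)>\<close>
definition weyl_form :: "((real \<times> real \<Rightarrow> complex) \<Rightarrow> complex) \<Rightarrow> (real \<Rightarrow> complex)
                         \<Rightarrow> (real \<Rightarrow> complex) \<Rightarrow> complex" where
  "weyl_form T f h = dpair T (wigner h f)"

end

theory Submission
  imports Defs "HOL-Probability.Characteristic_Functions"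
begin

text \<open>
  Bound the short-time Fourier transform \<open>V(x0, \<xi>0, \<omega>, \<eta>)\<close> of the Wigner distribution of two local
  sine functions \<open>h\<close>, \<open>f\<close> in two ways. The Gaussian is its own Fourier transform and the
  Wigner distribution has Fourier transform \<open>ft h (\<xi> + \<omega>/2) * cnj (ft f (\<xi> - \<omega>/2))\<close> in its first
  variable, so \<open>V\<close> decays to order \<open>N\<close> in both \<open>\<xi>0 + \<omega>/2\<close> and \<open>\<xi>0 - \<omega>/2\<close>, measured from the frequencies
  of \<open>h\<close> and \<open>f\<close>. As \<open>h\<close> and \<open>f\<close> have compact support, \<open>V\<close> decays faster than any power in
  \<open>x0\<close> and \<open>\<eta>\<close>, measured from the mean and the difference of their positions. Because \<open>s < N\<close>,
  geometric interpolation of the two bounds gives order \<open>s\<close> in all four variables, and integrating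
  against \<open>jb (\<omega>, \<eta>) powr (- s)\<close> only uses that this weight is integrable on the plane for \<open>s > 2\<close>.

  The order-\<open>N\<close> decay of \<open>ft b\<close> comes from that of \<open>V_b b\<close>: the Fourier transform
  of \<open>x \<mapsto> V_b b (x, \<xi>)\<close> at \<open>\<eta>\<close> is \<open>ft b (\<xi> + \<eta>) * cnj (ft b \<eta>)\<close>, and one fixes \<open>\<eta>\<close> with
  \<open>ft b \<eta> \<noteq> 0\<close>.
\<close>

section \<open>Japanese bracket and Gaussian\<close>

lemma jb_ge_1: "1 \<le> jb z"
  by (simp add: jb_def)

lemma jb_pos [simp]: "0 < jb z"
  using jb_ge_1[of z] by linarith

lemma jb_nonneg [simp]: "0 \<le> jb z"
  using jb_ge_1[of z] by linarith

lemma jb_uminus [simp]: "jb (- z) = jb z"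
  by (simp add: jb_def)

lemma jb_neq_0 [simp]: "jb z \<noteq> 0"
  using jb_pos[of z] by linarith

lemma jb_mono: "norm x \<le> norm y \<Longrightarrow> jb x \<le> jb y"
  by (simp add: jb_def power_mono)

lemma jb_powr_antimono:
  assumes "norm x \<le> norm y" "0 \<le> s"
  shows "jb y powr (- s) \<le> jb x powr (- s)"
  using jb_mono[OF assms(1)] assms(2) by (simp add: powr_mono2')

lemma borel_measurable_jb [measurable]: "jb \<in> borel_measurable borel"
  unfolding jb_def[abs_def] by measurable

lemma jb_sq: "(jb z)\<^sup>2 = 1 + (norm z)\<^sup>2"
  unfolding jb_def by (simp add: add_nonneg_nonneg)

lemma jb_Pair_sq: "(jb (x, y))\<^sup>2 = 1 + (norm x)\<^sup>2 + (norm y)\<^sup>2"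
  by (simp add: jb_sq norm_Pair add_nonneg_nonneg)

lemma jb_Pair_le_mult: "jb (x, y) \<le> jb x * jb y"
proof (rule power2_le_imp_le)
  have "0 \<le> (norm x)\<^sup>2 * (norm y)\<^sup>2"
    by simp
  then show "(jb (x, y))\<^sup>2 \<le> (jb x * jb y)\<^sup>2"
    unfolding power_mult_distrib jb_Pair_sq unfolding jb_sq by (simp add: algebra_simps)
qed simp

text \<open>This follows from the arithmetic-geometric mean inequality. It is the converse of
  \<open>jb_Pair_le_mult\<close> up to a square, and it allows a weight on the plane to be split
  into one-variable weights.\<close>

lemma jb_mult_le_Pair_sq: "jb x * jb y \<le> (jb (x, y))\<^sup>2"
proof -
  have "0 \<le> (jb x - jb y)\<^sup>2"
    by simp
  then have "2 * (jb x * jb y) \<le> (jb x)\<^sup>2 + (jb y)\<^sup>2"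
    by (simp add: power2_diff)
  also have "\<dots> \<le> 2 * (jb (x, y))\<^sup>2"
    unfolding jb_Pair_sq unfolding jb_sq by simp
  finally show ?thesis
    by simp
qed

lemma jb_add_le: "jb (x + y) \<le> 2 * jb x * jb y"
proof (rule power2_le_imp_le)
  have "(norm (x + y))\<^sup>2 \<le> (norm x + norm y)\<^sup>2"
    by (intro power_mono norm_triangle_ineq) simp
  also have "\<dots> \<le> 2 * (norm x)\<^sup>2 + 2 * (norm y)\<^sup>2"
    using sum_squares_bound[of "norm x" "norm y"] by (simp add: power2_sum)
  finally have "(norm (x + y))\<^sup>2 \<le> 2 * (norm x)\<^sup>2 + 2 * (norm y)\<^sup>2" .
  moreover have "0 \<le> (norm x)\<^sup>2 * (norm y)\<^sup>2"
    by simp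
  moreover have e: "2\<^sup>2 * (1 + p) * (1 + q) = 4 + 4 * p + 4 * q + 4 * (p * q)" for p q :: real
    by (simp add: algebra_simps)
  ultimately show "(jb (x + y))\<^sup>2 \<le> (2 * jb x * jb y)\<^sup>2"
    using zero_le_power2[of "norm x"] zero_le_power2[of "norm y"]
    unfolding power_mult_distrib jb_sq e by linarith
qed simp

text \<open>Peetre's inequality: \<open>jb_add_le\<close> is applied to x = (x + y) + (- y). It lets
  a peak be recentred at the price of a power of the bracket of the shift.\<close>

lemma peetre:
  assumes "0 \<le> s"
  shows "jb (x + y) powr (- s) \<le> 2 powr s * jb y powr s * jb x powr (- s)"
proof -
  have "jb x powr s \<le> (2 * jb (x + y) * jb y) powr s"
    using jb_add_le[of "x + y" "- y"] assms by (intro powr_mono2) auto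
  also have "\<dots> = 2 powr s * jb (x + y) powr s * jb y powr s"
    by (simp add: powr_mult)
  finally show ?thesis
    by (simp add: powr_minus divide_simps mult_ac)
qed

text \<open>The longer of x and y has at least half the norm of x - y, so its factor is absorbed
  into the bracket of x - y while the other factor is kept. This replaces a convolution estimate for
  the weights: integrating the right-hand side only requires integrability of one weight.\<close>

lemma jb_powr_mult_le:
  assumes "0 \<le> s"
  shows "jb x powr (- s) * jb y powr (- s)
    \<le> 2 powr s * jb (x - y) powr (- s) * (jb x powr (- s) + jb y powr (- s))"
proof -
  have *: "jb u powr (- s) \<le> 2 powr s * jb (x - y) powr (- s)"
    if "norm x \<le> norm u" "norm y \<le> norm u" for u :: 'a
  proof -
    have "jb (x - y) \<le> 2 * jb u"
    proof (rule power2_le_imp_le)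
      have "norm (x - y) \<le> 2 * norm u"
        using norm_triangle_ineq4[of x y] that by linarith
      then have "(norm (x - y))\<^sup>2 \<le> (2 * norm u)\<^sup>2"
        by (intro power_mono) auto
      then show "(jb (x - y))\<^sup>2 \<le> (2 * jb u)\<^sup>2"
        by (simp add: power_mult_distrib jb_sq)
    qed simp
    then have "jb (x - y) powr s \<le> (2 * jb u) powr s"
      using assms by (intro powr_mono2) auto
    then show ?thesis
      by (simp add: powr_mult powr_minus divide_simps mult_ac)
  qed
  show ?thesis
  proof (cases "norm x \<le> norm y")
    case True
    have "jb x powr (- s) * jb y powr (- s) \<le> jb x powr (- s) * (2 powr s * jb (x - y) powr (- s))"
      using True by (intro mult_left_mono *) auto
    also have "\<dots> \<le> 2 powr s * jb (x - y) powr (- s) * (jb x powr (- s) + jb y powr (- s))"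
      by (simp add: algebra_simps)
    finally show ?thesis .
  next
    case False
    have "jb x powr (- s) * jb y powr (- s) \<le> (2 powr s * jb (x - y) powr (- s)) * jb y powr (- s)"
      using False by (intro mult_right_mono *) auto
    also have "\<dots> \<le> 2 powr s * jb (x - y) powr (- s) * (jb x powr (- s) + jb y powr (- s))"
      by (simp add: algebra_simps)
    finally show ?thesis .
  qed
qed

lemma integrable_jb_powr:
  assumes "1 < s"
  shows "integrable lborel (\<lambda>y::real. jb y powr (- s))"
proof -
  have "set_integrable lborel {1..} (\<lambda>x::real. x powr (- s))"
    unfolding set_integrable_def
  proof (rule integrableI_nonneg)
    show "AE x in lborel. 0 \<le> indicator {1::real..} x *\<^sub>R x powr - s"
      by simp
    have "((\<lambda>x. x powr - s) has_integral - (1 powr (- s + 1)) / (- s + 1)) {1::real..}"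
      using assms by (intro has_integral_powr_to_inf) auto
    then have "(\<integral>\<^sup>+ x. ennreal (x powr - s) * indicator {1::real..} x \<partial>lborel)
      = ennreal (- (1 powr (- s + 1)) / (- s + 1))"
      by (intro nn_integral_has_integral_lebesgue') auto
    moreover have "(\<integral>\<^sup>+ x. ennreal (indicator {1::real..} x *\<^sub>R x powr - s) \<partial>lborel)
        = (\<integral>\<^sup>+ x. ennreal (x powr - s) * indicator {1::real..} x \<partial>lborel)"
      by (intro nn_integral_cong) (auto split: split_indicator)
    ultimately show "(\<integral>\<^sup>+ x. ennreal (indicator {1::real..} x *\<^sub>R x powr - s) \<partial>lborel) < \<infinity>"
      by simp
  qed simp
  then have i: "integrable lborel (\<lambda>x::real. indicator {1..} x * x powr (- s))"
    by (simp add: set_integrable_def)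
  then have j: "integrable lborel (\<lambda>x::real. indicator {1..} (- x) * (- x) powr (- s))"
    using lborel_integrable_real_affine[OF i, of "-1" 0] by simp
  have k: "integrable lborel (\<lambda>x::real. indicator {-1..1} x * (1::real))"
    by simp
  show ?thesis
  proof (rule Bochner_Integration.integrable_bound[OF Bochner_Integration.integrable_add[OF k
        Bochner_Integration.integrable_add[OF i j]]])
    show "AE y in lborel. norm (jb (y::real) powr - s) \<le> norm (indicator {-1..1} y * 1
       + (indicator {1..} y * y powr - s + indicator {1..} (- y) * (- y) powr - s))"
    proof (rule AE_I2)
      fix y :: real
      \<comment> \<open>The point 0 has to be excluded, since \<open>0 powr a\<close> is 0 by
        convention. The indicator of [-1, 1] covers it.\<close>
      have p: "jb y powr - s \<le> \<bar>y\<bar> powr - s" if "y \<noteq> 0"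
        using that assms real_le_rsqrt[of "\<bar>y\<bar>" "1 + y\<^sup>2"] by (intro powr_mono2') (auto simp: jb_def)
      have q: "jb y powr - s \<le> 1"
        using jb_ge_1[of y] assms powr_mono2'[of "-s" 1 "jb y"] by simp
      show "norm (jb y powr - s) \<le> norm (indicator {-1..1} y * 1
       + (indicator {1..} y * y powr - s + indicator {1..} (- y) * (- y) powr - s))"
        using p q by (cases "y \<le> -1"; cases "1 \<le> y") (auto split: split_indicator)
    qed
  qed measurable
qed

section \<open>The Gaussian in one variable: decay, moments and Fourier transform\<close>

definition gk :: "real \<Rightarrow> real" where
  "gk x = exp (- pi * x\<^sup>2)"

lemma gk_nonneg [simp]: "0 \<le> gk x"
  by (simp add: gk_def)

lemma gk_le_1 [simp]: "gk x \<le> 1"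
  by (simp add: gk_def)

lemma gk_minus: "gk (- x) = gk x"
  by (simp add: gk_def)

lemma borel_measurable_gk [measurable]: "gk \<in> borel_measurable borel"
  unfolding gk_def[abs_def] by measurable

text \<open>A single term of the exponential series at \<open>(jb x)\<^sup>2\<close> dominates any
  prescribed power of the bracket. The resulting factor exp (1 + x^2) is absorbed by the Gaussian
  because pi > 1.\<close>

lemma gk_le_jb_powr: "\<exists>C\<ge>0. \<forall>x. gk x \<le> C * jb x powr (- s)"
proof -
  define n where "n = nat \<lceil>s\<rceil>"
  have "gk x * jb x powr s \<le> exp 1 * fact n" for x
  proof -
    have "jb x powr s \<le> jb x powr real n"
      using jb_ge_1[of x] unfolding n_def by (intro powr_mono) linarith+
    also have "\<dots> = jb x ^ n"
      by (simp add: powr_realpow)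
    also have "\<dots> \<le> ((jb x)\<^sup>2) ^ n"
      using jb_ge_1[of x] by (intro power_mono) (auto simp: power2_eq_square)
    also have "\<dots> \<le> fact n * exp ((jb x)\<^sup>2)"
    proof -
      have "inverse (fact n) *\<^sub>R ((jb x)\<^sup>2) ^ n \<le> (\<Sum>k. inverse (fact k) *\<^sub>R ((jb x)\<^sup>2) ^ k)"
        using sum_le_suminf[of "\<lambda>k. ((jb x)\<^sup>2) ^ k /\<^sub>R fact k" "{n}"] summable_exp_generic[of "(jb x)\<^sup>2"]
        by auto
      then show ?thesis
        by (simp add: exp_def field_simps)
    qed
    finally have "gk x * jb x powr s \<le> gk x * (fact n * exp ((jb x)\<^sup>2))"
      by (intro mult_left_mono) auto
    also have "\<dots> = fact n * exp (1 + x\<^sup>2 - pi * x\<^sup>2)"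
      by (simp add: gk_def jb_sq exp_add exp_diff exp_minus field_simps)
    also have "\<dots> \<le> exp 1 * fact n"
      using pi_gt3 mult_right_mono[of 1 pi "x\<^sup>2"] by simp
    finally show ?thesis .
  qed
  then have "gk x \<le> exp 1 * fact n * jb x powr (- s)" for x
    by (simp add: powr_minus divide_simps)
  then show ?thesis
    by (intro exI[of _ "exp 1 * fact n"]) auto
qed

lemma integrable_gk_jb_powr: "integrable lborel (\<lambda>x. gk x * jb x powr s)"
proof -
  \<comment> \<open>Two orders more than the weight leave the exponent -2, which is integrable on
    the line.\<close>
  obtain C where C: "C \<ge> 0" "\<And>x. gk x \<le> C * jb x powr (- (s + 2))"
    using gk_le_jb_powr by metis
  show ?thesis
  proof (rule Bochner_Integration.integrable_bound)
    show "integrable lborel (\<lambda>x::real. C * jb x powr (- 2))"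
      using integrable_jb_powr[of 2] by simp
    have "gk x * jb x powr s \<le> C * jb x powr (- 2)" for x
    proof -
      have "gk x * jb x powr s \<le> C * jb x powr (- (s + 2)) * jb x powr s"
        using C by (intro mult_right_mono) auto
      also have "\<dots> = C * jb x powr (- 2)"
        by (simp add: powr_add[symmetric])
      finally show ?thesis .
    qed
    then show "AE x in lborel. norm (gk x * jb x powr s) \<le> norm (C * jb x powr - 2)"
      using C(1) by (intro AE_I2) auto
  qed measurable
qed

lemma integrable_gk: "integrable lborel gk"
  using integrable_gk_jb_powr[of 0] by simp

text \<open>The characteristic function of the standard normal distribution is rescaled by sqrt (2
  pi), which turns both the density and the phase into the normalisation with 2 pi in the
  exponent.\<close>

lemma gk_fourier: "(LINT r|lborel. complex_of_real (gk r) * cis (2 * pi * r * x)) = of_real (gk x)"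
proof -
  have "complex_of_real (exp (- ((sqrt (2*pi) * x)\<^sup>2) / 2)) = char std_normal_distribution (sqrt (2*pi) * x)"
    by (simp add: char_std_normal_distribution)
  also have "\<dots> = (LINT r|lborel. std_normal_density r *\<^sub>R iexp (sqrt (2*pi) * x * r))"
    unfolding char_def by (subst integral_density) auto
  also have "\<dots> = sqrt (2*pi) *\<^sub>R (LINT r|lborel. std_normal_density (0 + sqrt (2*pi) * r)
      *\<^sub>R iexp (sqrt (2*pi) * x * (0 + sqrt (2*pi) * r)))"
    by (subst lborel_integral_real_affine[of "sqrt (2*pi)" _ 0]) simp_all
  also have "\<dots> = (LINT r|lborel. complex_of_real (gk r) * cis (2 * pi * r * x))"
    unfolding integral_scaleR_right[symmetric]
  proof (rule Bochner_Integration.integral_cong[OF refl])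
    fix r :: real
    have "sqrt (2*pi) * x * (0 + sqrt (2*pi) * r) = (sqrt (2*pi))\<^sup>2 * r * x"
      by (simp add: power2_eq_square)
    then have 1: "sqrt (2*pi) * x * (0 + sqrt (2*pi) * r) = 2 * pi * r * x"
      by (simp only: real_sqrt_pow2) simp
    have 2: "sqrt (2*pi) * std_normal_density (0 + sqrt (2*pi) * r) = gk r"
      by (simp add: std_normal_density_def gk_def power_mult_distrib)
    show "sqrt (2*pi) *\<^sub>R (std_normal_density (0 + sqrt (2*pi) * r)
      *\<^sub>R iexp (sqrt (2*pi) * x * (0 + sqrt (2*pi) * r))) = complex_of_real (gk r) * cis (2 * pi * r * x)"
      unfolding 1 scaleR_scaleR 2 by (simp add: cis_conv_exp scaleR_conv_of_real)
  qed
  finally show ?thesis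
    by (simp add: gk_def power_mult_distrib)
qed

section \<open>Short-time Fourier transform of a Wigner distribution\<close>

text \<open>A nonintegrable \<open>f\<close> has integral 0 by convention, which lies below the
  nonnegative integral of \<open>g\<close>. Later estimates can thus be run from a pointwise
  majorant alone.\<close>

lemma norm_lint_le:
  fixes f :: "'a \<Rightarrow> 'b::{banach, second_countable_topology}"
  assumes "integrable M g" "\<And>x. norm (f x) \<le> g x"
  shows "norm (integral\<^sup>L M f) \<le> integral\<^sup>L M g"
proof (cases "integrable M f")
  case True
  then show ?thesis
    using assms by (intro order_trans[OF integral_norm_bound] integral_mono) auto
next
  case False
  have "0 \<le> integral\<^sup>L M g"
    using assms(2) norm_ge_zero order_trans by (intro integral_nonneg_AE AE_I2) blast
  with False show ?thesis
    by (simp add: not_integrable_integral_eq)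
qed

text \<open>This serves every exchange of integrals below: in each case the integrand has a product
  majorant built from indicators of intervals and Gaussians.\<close>

lemma integrable_lborel_pair_dominated:
  fixes F :: "real \<times> real \<Rightarrow> 'a::{banach, second_countable_topology}"
  assumes "F \<in> borel_measurable (lborel \<Otimes>\<^sub>M lborel)"
    and "\<And>x y. norm (F (x, y)) \<le> \<phi> x * \<psi> y"
    and \<phi>: "integrable lborel \<phi>" and \<psi>: "integrable lborel \<psi>"
  shows "integrable (lborel \<Otimes>\<^sub>M lborel) F"
proof (rule Bochner_Integration.integrable_bound)
  show "integrable (lborel \<Otimes>\<^sub>M lborel) (\<lambda>(x, y). \<phi> x * \<psi> y)"
  proof (rule lborel_pair.Fubini_integrable)
    show "(\<lambda>(x, y). \<phi> x * \<psi> y) \<in> borel_measurable (lborel \<Otimes>\<^sub>M lborel)"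
      using borel_measurable_integrable[OF \<phi>] borel_measurable_integrable[OF \<psi>] by measurable
    show "integrable lborel (\<lambda>x. LINT y|lborel. norm (case (x, y) of (x, y) \<Rightarrow> \<phi> x * \<psi> y))"
      using \<phi> by (simp add: abs_mult)
    show "AE x in lborel. integrable lborel (\<lambda>y. case (x, y) of (x, y) \<Rightarrow> \<phi> x * \<psi> y)"
      using \<psi> by simp
  qed
  show "AE z in lborel \<Otimes>\<^sub>M lborel. norm (F z) \<le> norm (case z of (x, y) \<Rightarrow> \<phi> x * \<psi> y)"
    using assms(2) by (intro AE_I2) (auto intro: order_trans[OF _ abs_ge_self])
qed (use assms(1) in simp)

lemma borel_measurable_cis [measurable (raw)]:
  "g \<in> borel_measurable M \<Longrightarrow> (\<lambda>x. cis (g x)) \<in> borel_measurable M"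
  by (rule borel_measurable_continuous_on[of cis]) (intro continuous_intros)

lemma borel_measurable_cnj [measurable (raw)]:
  "g \<in> borel_measurable M \<Longrightarrow> (\<lambda>x. cnj (g x)) \<in> borel_measurable M"
  by (rule borel_measurable_continuous_on[of cnj]) (intro continuous_intros)

lemma integrable_indicator_Icc [simp, intro]: "integrable lborel (indicator {a..b::real} :: real \<Rightarrow> real)"
  by (simp add: integrable_real_indicator emeasure_lborel_Icc_eq)

definition ft :: "(real \<Rightarrow> complex) \<Rightarrow> real \<Rightarrow> complex" where
  "ft f p = (LINT t|lborel. f t * cis (- 2 * pi * p * t))"

text \<open>Two functions with supports centred at \<open>a\<close> and \<open>c\<close>, with
  common radius \<open>R\<close> and common bound \<open>B\<close>. Keeping the centres explicit
  makes all later constants independent of the positions of the functions.\<close>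

locale compact_pair =
  fixes h f :: "real \<Rightarrow> complex" and a c B R :: real
  assumes h_measurable [measurable]: "h \<in> borel_measurable borel"
    and f_measurable [measurable]: "f \<in> borel_measurable borel"
    and h_bound: "\<And>u. norm (h u) \<le> B * indicator {a - R..a + R} u"
    and f_bound: "\<And>u. norm (f u) \<le> B * indicator {c - R..c + R} u"
    and R_nonneg: "0 \<le> R" and B_nonneg: "0 \<le> B"
begin

text \<open>The variable x is the midpoint of the two arguments and t is their difference. Hence x
  stays within R of the midpoint of the centres, and t within 2R of their difference.\<close>

lemma tensor_bound:
  "norm (h (x + t / 2) * cnj (f (x - t / 2)))
    \<le> B\<^sup>2 * indicator {(a + c) / 2 - R..(a + c) / 2 + R} x * indicator {a - c - 2 * R..a - c + 2 * R} t"
proof -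
  have "norm (h (x + t / 2) * cnj (f (x - t / 2)))
    \<le> (B * indicator {a - R..a + R} (x + t / 2)) * (B * indicator {c - R..c + R} (x - t / 2))"
    unfolding norm_mult complex_mod_cnj by (intro mult_mono h_bound f_bound) (use B_nonneg in auto)
  also have "\<dots> = B\<^sup>2 * (indicator {a - R..a + R} (x + t / 2) * indicator {c - R..c + R} (x - t / 2))"
    by (simp add: power2_eq_square)
  also have "\<dots> \<le> B\<^sup>2 * (indicator {(a + c) / 2 - R..(a + c) / 2 + R} x * indicator {a - c - 2 * R..a - c + 2 * R} t)"
    by (intro mult_left_mono) (auto simp: field_simps split: split_indicator)
  finally show ?thesis
    by (simp add: mult.assoc)
qed

lemma wigner_cis:
  "wigner h f (x, \<xi>) = (LINT t|lborel. h (x + t / 2) * cnj (f (x - t / 2)) * cis (- 2 * pi * t * \<xi>))"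
  unfolding wigner_def by (simp add: cis_conv_exp mult_ac)

lemma wigner_bound:
  "norm (wigner h f (x, \<xi>)) \<le> 4 * R * B\<^sup>2 * indicator {(a + c) / 2 - R..(a + c) / 2 + R} x"
proof -
  have "norm (wigner h f (x, \<xi>)) \<le> (LINT t|lborel. B\<^sup>2 * indicator {(a + c) / 2 - R..(a + c) / 2 + R} x * indicator {a - c - 2 * R..a - c + 2 * R} t)"
    unfolding wigner_cis using tensor_bound[of x]
    by (intro norm_lint_le) (auto simp: norm_mult)
  also have "\<dots> = 4 * R * B\<^sup>2 * indicator {(a + c) / 2 - R..(a + c) / 2 + R} x"
    using R_nonneg by simp
  finally show ?thesis .
qed

lemma wigner_measurable [measurable]:
  "(\<lambda>(x, \<xi>). wigner h f (x, \<xi>)) \<in> borel_measurable (lborel \<Otimes>\<^sub>M lborel)"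
  unfolding wigner_cis split_beta'
  by (rule lborel.borel_measurable_lebesgue_integral) measurable

lemma wigner_measurable1 [measurable]: "(\<lambda>x. wigner h f (x, \<xi>)) \<in> borel_measurable borel"
  unfolding wigner_cis split_beta'
  by (rule lborel.borel_measurable_lebesgue_integral[where N=borel]) measurable

text \<open>The substitutions u = x + t/2 for fixed x, and then v = 2x - u for fixed u, turn the
  arguments of h and f into independent variables, so the double integral factors. Their Jacobians 2
  and 1/2 cancel.\<close>

lemma wigner_marginal:
  "(LINT x|lborel. wigner h f (x, \<xi>) * cis (- 2 * pi * \<omega> * x))
    = ft h (\<xi> + \<omega> / 2) * cnj (ft f (\<xi> - \<omega> / 2))"
proof -
  let ?F = "\<lambda>x u. 2 * (h u * cnj (f (2 * x - u)) * cis (- 4 * pi * (u - x) * \<xi>) * cis (- 2 * pi * \<omega> * x))"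
  have "wigner h f (x, \<xi>) = (LINT u|lborel. 2 * (h u * cnj (f (2 * x - u)) * cis (- 4 * pi * (u - x) * \<xi>)))" for x
  proof -
    have "wigner h f (x, \<xi>) = 2 *\<^sub>R (LINT u|lborel. h (x + (- 2 * x + 2 * u) / 2) * cnj (f (x - (- 2 * x + 2 * u) / 2))
        * cis (- 2 * pi * (- 2 * x + 2 * u) * \<xi>))"
      unfolding wigner_cis by (subst lborel_integral_real_affine[of 2 _ "- 2 * x"]) auto
    also have "\<dots> = (LINT u|lborel. 2 * (h u * cnj (f (2 * x - u)) * cis (- 4 * pi * (u - x) * \<xi>)))"
      unfolding integral_scaleR_right[symmetric]
    proof (rule Bochner_Integration.integral_cong[OF refl])
      fix u
      have e: "x + (- 2 * x + 2 * u) / 2 = u" "x - (- 2 * x + 2 * u) / 2 = 2 * x - u"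
        "- 2 * pi * (- 2 * x + 2 * u) * \<xi> = - 4 * pi * (u - x) * \<xi>"
        by (simp_all add: field_simps)
      show "2 *\<^sub>R (h (x + (- 2 * x + 2 * u) / 2) * cnj (f (x - (- 2 * x + 2 * u) / 2))
        * cis (- 2 * pi * (- 2 * x + 2 * u) * \<xi>)) = 2 * (h u * cnj (f (2 * x - u)) * cis (- 4 * pi * (u - x) * \<xi>))"
        unfolding e by (simp add: scaleR_conv_of_real)
    qed
    finally show ?thesis .
  qed
  then have "(LINT x|lborel. wigner h f (x, \<xi>) * cis (- 2 * pi * \<omega> * x)) = (LINT x|lborel. LINT u|lborel. ?F x u)"
    by (simp only: integral_mult_left_zero[symmetric] mult.assoc)
  also have "\<dots> = (LINT u|lborel. LINT x|lborel. ?F x u)"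
  proof (rule lborel_pair.Fubini_integral[symmetric], rule integrable_lborel_pair_dominated)
    fix x u
    have "norm (h u * cnj (f (2 * x - u))) \<le> B\<^sup>2 * indicator {(a + c) / 2 - R..(a + c) / 2 + R} x
       * indicator {a - R..a + R} u"
    \<comment> \<open>The majorant must be a product in x and u. The indicator in t = 2(u - x) is
      bounded by 1, and the support of h supplies the indicator in u.\<close>
    proof (cases "u \<in> {a - R..a + R}")
      case True
      have "norm (h u * cnj (f (2 * x - u))) \<le> B\<^sup>2 * indicator {(a + c) / 2 - R..(a + c) / 2 + R} x
          * indicator {a - c - 2 * R..a - c + 2 * R} (2 * (u - x))"
      proof -
        have "x + 2 * (u - x) / 2 = u" "x - 2 * (u - x) / 2 = 2 * x - u"
          by (simp_all add: field_simps)
        then show ?thesis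
          using tensor_bound[of x "2 * (u - x)"] by (simp only:)
      qed
      also have "\<dots> \<le> B\<^sup>2 * indicator {(a + c) / 2 - R..(a + c) / 2 + R} x * 1"
        by (intro mult_left_mono) (auto split: split_indicator)
      finally show ?thesis
        using True by simp
    next
      case False
      then show ?thesis
        using h_bound[of u] by simp
    qed
    then show "norm (case (x, u) of (x, u) \<Rightarrow> ?F x u) \<le>
      (2 * B\<^sup>2 * indicator {(a + c) / 2 - R..(a + c) / 2 + R} x) * indicator {a - R..a + R} u"
      by (simp add: norm_mult)
  qed (use R_nonneg in auto)
  also have "\<dots> = (LINT u|lborel. h u * cis (- 2 * pi * (\<xi> + \<omega> / 2) * u) *
      (LINT v|lborel. cnj (f v * cis (- 2 * pi * (\<xi> - \<omega> / 2) * v))))"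
  proof (rule Bochner_Integration.integral_cong[OF refl])
    fix u
    have "(LINT x|lborel. ?F x u) = (1/2) *\<^sub>R (LINT v|lborel. ?F (u / 2 + 1 / 2 * v) u)"
      by (subst lborel_integral_real_affine[of "1 / 2" _ "u / 2"]) auto
    also have "\<dots> = (LINT v|lborel. (h u * cis (- 2 * pi * (\<xi> + \<omega> / 2) * u)) *
      cnj (f v * cis (- 2 * pi * (\<xi> - \<omega> / 2) * v)))"
      unfolding integral_scaleR_right[symmetric]
    proof (rule Bochner_Integration.integral_cong[OF refl])
      fix v
      have "cis (- 4 * pi * (u - (u / 2 + 1 / 2 * v)) * \<xi>) * cis (- 2 * pi * \<omega> * (u / 2 + 1 / 2 * v))
        = cis (- 2 * pi * (\<xi> + \<omega> / 2) * u) * cnj (cis (- 2 * pi * (\<xi> - \<omega> / 2) * v))"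
        unfolding cis_cnj cis_mult by (rule arg_cong[of _ _ cis]) (simp add: field_simps)
      then show "(1/2) *\<^sub>R ?F (u / 2 + 1 / 2 * v) u = (h u * cis (- 2 * pi * (\<xi> + \<omega> / 2) * u)) *
        cnj (f v * cis (- 2 * pi * (\<xi> - \<omega> / 2) * v))"
        by (simp add: scaleR_conv_of_real mult_ac)
    qed
    finally show "(LINT x|lborel. ?F x u) = h u * cis (- 2 * pi * (\<xi> + \<omega> / 2) * u) *
      (LINT v|lborel. cnj (f v * cis (- 2 * pi * (\<xi> - \<omega> / 2) * v)))"
      by simp
  qed
  also have "\<dots> = ft h (\<xi> + \<omega> / 2) * cnj (ft f (\<xi> - \<omega> / 2))"
    unfolding ft_def Bochner_Integration.integral_cnj by (rule integral_mult_left_zero)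
  finally show ?thesis .
qed

text \<open>Writing the window \<open>gk (x - x0)\<close> as the Fourier integral of
  \<open>gk\<close> makes it a superposition of modulations. Each modulation by r shifts \<omega> to
  \<omega> - r in \<open>wigner_marginal\<close>.\<close>

lemma windowed_marginal:
  "(LINT x|lborel. wigner h f (x, \<xi>) * (gk (x - x0) * cis (- 2 * pi * \<omega> * x)))
    = (LINT r|lborel. gk r * cis (- 2 * pi * r * x0)
        * (ft h (\<xi> + (\<omega> - r) / 2) * cnj (ft f (\<xi> - (\<omega> - r) / 2))))"
proof -
  let ?F = "\<lambda>x r. wigner h f (x, \<xi>) * (gk r * cis (2 * pi * r * (x - x0)) * cis (- 2 * pi * \<omega> * x))"
  have "(LINT x|lborel. wigner h f (x, \<xi>) * (gk (x - x0) * cis (- 2 * pi * \<omega> * x)))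
    = (LINT x|lborel. LINT r|lborel. ?F x r)"
  proof (rule Bochner_Integration.integral_cong[OF refl])
    fix x
    have "(LINT r|lborel. ?F x r) = wigner h f (x, \<xi>) * ((LINT r|lborel. gk r * cis (2 * pi * r * (x - x0)))
      * cis (- 2 * pi * \<omega> * x))"
      by simp
    then show "wigner h f (x, \<xi>) * (gk (x - x0) * cis (- 2 * pi * \<omega> * x)) = (LINT r|lborel. ?F x r)"
      by (simp only: gk_fourier)
  qed
  also have "\<dots> = (LINT r|lborel. LINT x|lborel. ?F x r)"
  proof (rule lborel_pair.Fubini_integral[symmetric], rule integrable_lborel_pair_dominated)
    show "norm (case (x, r) of (x, r) \<Rightarrow> ?F x r) \<le>
      (4 * R * B\<^sup>2 * indicator {(a + c) / 2 - R..(a + c) / 2 + R} x) * gk r" for x r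
      using wigner_bound[of x \<xi>] by (simp add: norm_mult mult_right_mono)
  qed (use R_nonneg in \<open>auto intro: integrable_gk\<close>)
  also have "\<dots> = (LINT r|lborel. gk r * cis (- 2 * pi * r * x0)
        * (ft h (\<xi> + (\<omega> - r) / 2) * cnj (ft f (\<xi> - (\<omega> - r) / 2))))"
  proof (rule Bochner_Integration.integral_cong[OF refl])
    fix r
    have "(LINT x|lborel. ?F x r) = (LINT x|lborel. gk r * cis (- 2 * pi * r * x0)
        * (wigner h f (x, \<xi>) * cis (- 2 * pi * (\<omega> - r) * x)))"
    proof (rule Bochner_Integration.integral_cong[OF refl])
      fix x
      have "cis (2 * pi * r * (x - x0)) * cis (- 2 * pi * \<omega> * x) = cis (- 2 * pi * r * x0) * cis (- 2 * pi * (\<omega> - r) * x)"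
        unfolding cis_mult by (rule arg_cong[of _ _ cis]) (simp add: field_simps)
      then show "?F x r = gk r * cis (- 2 * pi * r * x0) * (wigner h f (x, \<xi>) * cis (- 2 * pi * (\<omega> - r) * x))"
        by (simp add: mult_ac)
    qed
    then show "(LINT x|lborel. ?F x r) = gk r * cis (- 2 * pi * r * x0)
        * (ft h (\<xi> + (\<omega> - r) / 2) * cnj (ft f (\<xi> - (\<omega> - r) / 2)))"
      unfolding wigner_marginal[symmetric] by simp
  qed
  finally show ?thesis .
qed

lemma stft2_wigner_integrable:
  "integrable (lborel \<Otimes>\<^sub>M lborel) (\<lambda>(x, \<xi>). complex_of_real (sqrt 2) * gk (\<xi> - \<xi>0) * cis (- 2 * pi * \<eta> * \<xi>)
     * (wigner h f (x, \<xi>) * (gk (x - x0) * cis (- 2 * pi * \<omega> * x))))"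
proof (rule integrable_lborel_pair_dominated)
  show "norm (case (x, \<xi>) of (x, \<xi>) \<Rightarrow> complex_of_real (sqrt 2) * gk (\<xi> - \<xi>0) * cis (- 2 * pi * \<eta> * \<xi>)
     * (wigner h f (x, \<xi>) * (gk (x - x0) * cis (- 2 * pi * \<omega> * x))))
     \<le> (4 * R * B\<^sup>2 * indicator {(a + c) / 2 - R..(a + c) / 2 + R} x) * (sqrt 2 * gk (\<xi> - \<xi>0))" for x \<xi>
  proof -
    have "norm (wigner h f (x, \<xi>)) * gk (x - x0) \<le>
       (4 * R * B\<^sup>2 * indicator {(a + c) / 2 - R..(a + c) / 2 + R} x) * 1"
      using R_nonneg by (intro mult_mono wigner_bound) auto
    from mult_right_mono[OF this, of "sqrt 2 * gk (\<xi> - \<xi>0)"] show ?thesis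
      by (simp add: norm_mult mult_ac)
  qed
  show "integrable lborel (\<lambda>\<xi>. sqrt 2 * gk (\<xi> - \<xi>0))"
    using lborel_integrable_real_affine[OF integrable_gk, of 1 "- \<xi>0"] by simp
qed (use R_nonneg in auto)

text \<open>The window \<open>gauss2\<close> is sqrt 2 times a product of two copies of
  \<open>gk\<close>. The integral over the plane can then be iterated in either order: x first for
  the bound in frequency, \<xi> first for the bound in space.\<close>

lemma stft2_wigner_eq:
  "stft2 (wigner h f) ((x0, \<xi>0), (\<omega>, \<eta>)) = integral\<^sup>L (lborel \<Otimes>\<^sub>M lborel)
    (\<lambda>(x, \<xi>). complex_of_real (sqrt 2) * gk (\<xi> - \<xi>0) * cis (- 2 * pi * \<eta> * \<xi>)
     * (wigner h f (x, \<xi>) * (gk (x - x0) * cis (- 2 * pi * \<omega> * x))))"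
  unfolding stft2_def lborel_prod
proof (rule Bochner_Integration.integral_cong[OF refl])
  fix w :: "real \<times> real"
  obtain x \<xi> where w: "w = (x, \<xi>)"
    by fastforce
  have "cnj (tfshift2 ((x0, \<xi>0), (\<omega>, \<eta>)) gauss2 w)
    = cis (- (2 * pi * (\<omega> * x + \<eta> * \<xi>))) * (sqrt 2 * exp (- pi * ((x - x0)\<^sup>2 + (\<xi> - \<xi>0)\<^sup>2)))"
    by (simp add: tfshift2_def gauss2_def w norm_Pair exp_cnj cis_conv_exp mult_ac)
  also have "cis (- (2 * pi * (\<omega> * x + \<eta> * \<xi>))) = cis (- 2 * pi * \<eta> * \<xi>) * cis (- 2 * pi * \<omega> * x)"
    unfolding cis_mult by (rule arg_cong[of _ _ cis]) (simp add: field_simps)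
  also have "exp (- pi * ((x - x0)\<^sup>2 + (\<xi> - \<xi>0)\<^sup>2)) = gk (x - x0) * gk (\<xi> - \<xi>0)"
    by (simp add: gk_def distrib_left exp_add exp_diff exp_minus field_simps)
  finally show "wigner h f w * cnj (tfshift2 ((x0, \<xi>0), \<omega>, \<eta>) gauss2 w) =
    (case w of (x, \<xi>) \<Rightarrow> complex_of_real (sqrt 2) * gk (\<xi> - \<xi>0) * cis (- 2 * pi * \<eta> * \<xi>)
     * (wigner h f (x, \<xi>) * (gk (x - x0) * cis (- 2 * pi * \<omega> * x))))"
    by (simp add: w mult_ac)
qed

end

section \<open>Frequency and space bounds for the short-time Fourier transform of a Wigner
  distribution\<close>

lemma integrable_gk_shift: "integrable lborel (\<lambda>x. gk (x - y) * jb (x - y) powr s)"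
  using lborel_integrable_real_affine[OF integrable_gk_jb_powr, of 1 "- y" s] by simp

lemma lint_gk_shift: "(LINT x|lborel. gk (x - y) * jb (x - y) powr s) = (LINT x|lborel. gk x * jb x powr s)"
  using lborel_integral_real_affine[of 1 "\<lambda>x. gk x * jb x powr s" "- y"] by simp

lemma gk_shift_fourier:
  "(LINT r|lborel. complex_of_real (gk (r - y)) * cis (2 * pi * r * x)) = cis (2 * pi * y * x) * of_real (gk x)"
proof -
  have "(LINT r|lborel. complex_of_real (gk (r - y)) * cis (2 * pi * r * x))
    = (LINT r|lborel. cis (2 * pi * y * x) * (complex_of_real (gk r) * cis (2 * pi * r * x)))"
    by (subst lborel_integral_real_affine[of 1 _ y])
       (auto simp: cis_mult algebra_simps intro!: Bochner_Integration.integral_cong)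
  then show ?thesis
    by (simp only: integral_mult_right_zero gk_fourier)
qed

context compact_pair
begin

text \<open>The majorants H and K are moderate: a shift by y costs at most
  \<open>D * jb y powr n\<close>. The arguments of both are displaced twice, by r/2 in the
  x-integral and by \<xi> - \<xi>0 in the \<xi>-integral. Each displacement costs D^2 and a weight
  of order 2n, which the Gaussian integrates; this gives D^4 and the squared moment.\<close>

lemma stft2_wigner_bound_freq:
  assumes H: "\<And>p. norm (ft h p) \<le> H p" and K: "\<And>p. norm (ft f p) \<le> K p"
    and H_mod: "\<And>p y. H (p + y) \<le> D * jb y powr n * H p"
    and K_mod: "\<And>p y. K (p + y) \<le> D * jb y powr n * K p"
    and "0 \<le> n" "0 \<le> D"
  shows "norm (stft2 (wigner h f) ((x0, \<xi>0), (\<omega>, \<eta>)))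
    \<le> sqrt 2 * D ^ 4 * (LINT r|lborel. gk r * jb r powr (2 * n))\<^sup>2 * (H (\<xi>0 + \<omega> / 2) * K (\<xi>0 - \<omega> / 2))"
proof -
  define M where "M = (LINT r|lborel. gk r * jb r powr (2 * n))"
  have M0: "0 \<le> M"
    unfolding M_def by (intro integral_nonneg_AE AE_I2) simp
  have H0: "0 \<le> H p" and K0: "0 \<le> K p" for p
    using H[of p] K[of p] norm_ge_zero order_trans by blast+
  \<comment> \<open>The two shifts may differ, but both are controlled by the same r, so their costs
    merge into one weight of order 2n.\<close>
  have HK: "H (p + y) * K (q + y') \<le> D\<^sup>2 * jb r powr (2 * n) * (H p * K q)"
    if "\<bar>y\<bar> \<le> \<bar>r\<bar>" "\<bar>y'\<bar> \<le> \<bar>r\<bar>" for p q y y' r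
  proof -
    have le: "jb z powr n \<le> jb r powr n" if "\<bar>z\<bar> \<le> \<bar>r\<bar>" for z
      using that \<open>0 \<le> n\<close> by (intro powr_mono2 jb_mono) auto
    have "H (p + y) * K (q + y') \<le> (D * jb r powr n * H p) * (D * jb r powr n * K q)"
      using that \<open>0 \<le> D\<close> H0 K0
      by (intro mult_mono order_trans[OF H_mod] order_trans[OF K_mod] mult_right_mono mult_left_mono le) auto
    also have "\<dots> = D\<^sup>2 * (jb r powr n * jb r powr n) * (H p * K q)"
      by (simp add: power2_eq_square mult_ac)
    finally show ?thesis
      by (simp add: powr_add[symmetric])
  qed
  have inner: "norm (LINT x|lborel. wigner h f (x, \<xi>) * (gk (x - x0) * cis (- 2 * pi * \<omega> * x)))
      \<le> M * (D\<^sup>2 * (H (\<xi> + \<omega> / 2) * K (\<xi> - \<omega> / 2)))" for \<xi>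
  proof -
    have "norm (LINT x|lborel. wigner h f (x, \<xi>) * (gk (x - x0) * cis (- 2 * pi * \<omega> * x)))
      \<le> (LINT r|lborel. gk r * jb r powr (2 * n) * (D\<^sup>2 * (H (\<xi> + \<omega> / 2) * K (\<xi> - \<omega> / 2))))"
      unfolding windowed_marginal
    proof (rule norm_lint_le)
      fix r
      have e: "\<xi> + (\<omega> - r) / 2 = (\<xi> + \<omega> / 2) + (- r / 2)" "\<xi> - (\<omega> - r) / 2 = (\<xi> - \<omega> / 2) + r / 2"
        by (simp_all add: field_simps)
      have "norm (ft h (\<xi> + (\<omega> - r) / 2)) * norm (ft f (\<xi> - (\<omega> - r) / 2))
        \<le> H (\<xi> + (\<omega> - r) / 2) * K (\<xi> - (\<omega> - r) / 2)"
        by (intro mult_mono H K H0) simp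
      also have "\<dots> \<le> D\<^sup>2 * jb r powr (2 * n) * (H (\<xi> + \<omega> / 2) * K (\<xi> - \<omega> / 2))"
        unfolding e by (rule HK) auto
      finally show "norm (complex_of_real (gk r) * cis (- 2 * pi * r * x0) *
          (ft h (\<xi> + (\<omega> - r) / 2) * cnj (ft f (\<xi> - (\<omega> - r) / 2))))
          \<le> gk r * jb r powr (2 * n) * (D\<^sup>2 * (H (\<xi> + \<omega> / 2) * K (\<xi> - \<omega> / 2)))"
        using mult_left_mono[OF _ gk_nonneg[of r]] by (fastforce simp: norm_mult mult_ac)
    qed (intro Bochner_Integration.integrable_mult_left integrable_gk_jb_powr)
    then show ?thesis
      by (simp add: M_def)
  qed
  have "stft2 (wigner h f) ((x0, \<xi>0), (\<omega>, \<eta>)) = (LINT \<xi>|lborel. LINT x|lborel.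
     complex_of_real (sqrt 2) * gk (\<xi> - \<xi>0) * cis (- 2 * pi * \<eta> * \<xi>)
     * (wigner h f (x, \<xi>) * (gk (x - x0) * cis (- 2 * pi * \<omega> * x))))"
    unfolding stft2_wigner_eq by (rule lborel_pair.integral_snd[OF stft2_wigner_integrable, symmetric])
  also have "\<dots> = (LINT \<xi>|lborel. complex_of_real (sqrt 2) * gk (\<xi> - \<xi>0) * cis (- 2 * pi * \<eta> * \<xi>)
     * (LINT x|lborel. wigner h f (x, \<xi>) * (gk (x - x0) * cis (- 2 * pi * \<omega> * x))))"
    by (simp only: integral_mult_right_zero)
  finally have eq: "stft2 (wigner h f) ((x0, \<xi>0), (\<omega>, \<eta>)) = \<dots>" .
  have "norm (stft2 (wigner h f) ((x0, \<xi>0), (\<omega>, \<eta>))) \<le> (LINT \<xi>|lborel. gk (\<xi> - \<xi>0) * jb (\<xi> - \<xi>0) powr (2 * n)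
      * (sqrt 2 * M * D\<^sup>2 * (D\<^sup>2 * (H (\<xi>0 + \<omega> / 2) * K (\<xi>0 - \<omega> / 2)))))"
    unfolding eq
  proof (rule norm_lint_le)
    fix \<xi>
    have "H (\<xi> + \<omega> / 2) * K (\<xi> - \<omega> / 2) = H ((\<xi>0 + \<omega> / 2) + (\<xi> - \<xi>0)) * K ((\<xi>0 - \<omega> / 2) + (\<xi> - \<xi>0))"
      by (simp add: algebra_simps)
    also have "\<dots> \<le> D\<^sup>2 * jb (\<xi> - \<xi>0) powr (2 * n) * (H (\<xi>0 + \<omega> / 2) * K (\<xi>0 - \<omega> / 2))"
      by (rule HK) auto
    finally have le: "M * (D\<^sup>2 * (H (\<xi> + \<omega> / 2) * K (\<xi> - \<omega> / 2)))
      \<le> M * (D\<^sup>2 * (D\<^sup>2 * jb (\<xi> - \<xi>0) powr (2 * n) * (H (\<xi>0 + \<omega> / 2) * K (\<xi>0 - \<omega> / 2))))"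
      using M0 by (intro mult_left_mono) auto
    have "norm (complex_of_real (sqrt 2) * gk (\<xi> - \<xi>0) * cis (- 2 * pi * \<eta> * \<xi>)
     * (LINT x|lborel. wigner h f (x, \<xi>) * (gk (x - x0) * cis (- 2 * pi * \<omega> * x))))
      = (sqrt 2 * gk (\<xi> - \<xi>0)) * norm (LINT x|lborel. wigner h f (x, \<xi>) * (gk (x - x0) * cis (- 2 * pi * \<omega> * x)))"
      by (simp add: norm_mult)
    also have "\<dots> \<le> (sqrt 2 * gk (\<xi> - \<xi>0)) * (M * (D\<^sup>2 * (D\<^sup>2 * jb (\<xi> - \<xi>0) powr (2 * n) * (H (\<xi>0 + \<omega> / 2) * K (\<xi>0 - \<omega> / 2)))))"
      by (intro mult_left_mono order_trans[OF inner le]) simp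
    finally show "norm (complex_of_real (sqrt 2) * gk (\<xi> - \<xi>0) * cis (- 2 * pi * \<eta> * \<xi>)
     * (LINT x|lborel. wigner h f (x, \<xi>) * (gk (x - x0) * cis (- 2 * pi * \<omega> * x))))
      \<le> gk (\<xi> - \<xi>0) * jb (\<xi> - \<xi>0) powr (2 * n)
      * (sqrt 2 * M * D\<^sup>2 * (D\<^sup>2 * (H (\<xi>0 + \<omega> / 2) * K (\<xi>0 - \<omega> / 2))))"
      by (simp add: mult_ac)
  qed (intro Bochner_Integration.integrable_mult_left integrable_gk_shift)
  also have "\<dots> = sqrt 2 * D ^ 4 * M\<^sup>2 * (H (\<xi>0 + \<omega> / 2) * K (\<xi>0 - \<omega> / 2))"
    unfolding integral_mult_left_zero lint_gk_shift M_def[symmetric]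
    by (simp add: power2_eq_square eval_nat_numeral)
  finally show ?thesis
    unfolding M_def .
qed

text \<open>With \<xi> integrated first, the Gaussian window in \<xi> becomes, up to a phase, a
  Gaussian in t centred at -\<eta>. This is where decay in \<eta> comes from.\<close>

lemma wigner_windowed_freq:
  "(LINT \<xi>|lborel. wigner h f (x, \<xi>) * (gk (\<xi> - \<xi>0) * cis (- 2 * pi * \<eta> * \<xi>)))
    = (LINT t|lborel. h (x + t / 2) * cnj (f (x - t / 2)) * (cis (2 * pi * \<xi>0 * (- t - \<eta>)) * gk (- t - \<eta>)))"
proof -
  let ?F = "\<lambda>\<xi> t. h (x + t / 2) * cnj (f (x - t / 2)) * cis (- 2 * pi * t * \<xi>) * (gk (\<xi> - \<xi>0) * cis (- 2 * pi * \<eta> * \<xi>))"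
  have "(LINT \<xi>|lborel. wigner h f (x, \<xi>) * (gk (\<xi> - \<xi>0) * cis (- 2 * pi * \<eta> * \<xi>))) = (LINT \<xi>|lborel. LINT t|lborel. ?F \<xi> t)"
    by (simp only: wigner_cis integral_mult_left_zero)
  also have "\<dots> = (LINT t|lborel. LINT \<xi>|lborel. ?F \<xi> t)"
  proof (rule lborel_pair.Fubini_integral[symmetric], rule integrable_lborel_pair_dominated)
    show "norm (case (\<xi>, t) of (\<xi>, t) \<Rightarrow> ?F \<xi> t) \<le>
      gk (\<xi> - \<xi>0) * (B\<^sup>2 * indicator {(a + c) / 2 - R..(a + c) / 2 + R} x * indicator {a - c - 2 * R..a - c + 2 * R} t)" for \<xi> t
      using mult_left_mono[OF tensor_bound[of x t] gk_nonneg[of "\<xi> - \<xi>0"]] by (simp add: norm_mult mult_ac)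
    show "integrable lborel (\<lambda>\<xi>. gk (\<xi> - \<xi>0))"
      using integrable_gk_shift[of \<xi>0 0] by simp
  qed auto
  also have "\<dots> = (LINT t|lborel. h (x + t / 2) * cnj (f (x - t / 2)) * (cis (2 * pi * \<xi>0 * (- t - \<eta>)) * gk (- t - \<eta>)))"
  proof (rule Bochner_Integration.integral_cong[OF refl])
    fix t
    have "(LINT \<xi>|lborel. ?F \<xi> t) = (LINT \<xi>|lborel. h (x + t / 2) * cnj (f (x - t / 2)) * (gk (\<xi> - \<xi>0) * cis (2 * pi * \<xi> * (- t - \<eta>))))"
    proof (rule Bochner_Integration.integral_cong[OF refl])
      fix \<xi>
      have "cis (- 2 * pi * t * \<xi>) * cis (- 2 * pi * \<eta> * \<xi>) = cis (2 * pi * \<xi> * (- t - \<eta>))"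
        unfolding cis_mult by (rule arg_cong[of _ _ cis]) (simp add: field_simps)
      then show "?F \<xi> t = h (x + t / 2) * cnj (f (x - t / 2)) * (gk (\<xi> - \<xi>0) * cis (2 * pi * \<xi> * (- t - \<eta>)))"
        by (simp add: mult_ac)
    qed
    then show "(LINT \<xi>|lborel. ?F \<xi> t) = h (x + t / 2) * cnj (f (x - t / 2)) * (cis (2 * pi * \<xi>0 * (- t - \<eta>)) * gk (- t - \<eta>))"
      by (simp only: integral_mult_right_zero gk_shift_fourier)
  qed
  finally show ?thesis .
qed

text \<open>The supports confine x to distance R from the midpoint of the centres, and t to distance
  2R from their difference. The Gaussians at x - x0 and - t - \<eta> are therefore small unless x0
  and -\<eta> are near these points, and Peetre's inequality moves the centres there. The factor 8
  R^2 is the product of the lengths 2R and 4R.\<close>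

lemma stft2_wigner_bound_space:
  assumes G: "\<And>x. gk x \<le> G * jb x powr (- M)" and "0 \<le> M" "0 \<le> G"
  shows "norm (stft2 (wigner h f) ((x0, \<xi>0), (\<omega>, \<eta>)))
    \<le> 8 * sqrt 2 * R\<^sup>2 * B\<^sup>2 * G\<^sup>2 * (2 powr M * jb R powr M) * (2 powr M * jb (2 * R) powr M)
      * (jb (x0 - (a + c) / 2) powr (- M) * jb (\<eta> + (a - c)) powr (- M))"
proof -
  let ?m = "(a + c) / 2" and ?d = "a - c"
  have gk_le: "gk (u + v) \<le> G * (2 powr M * jb r powr M) * jb u powr (- M)" if "\<bar>v\<bar> \<le> r" for u v r :: real
  proof -
    have "gk (u + v) \<le> G * (2 powr M * jb v powr M * jb u powr (- M))"
      using assms peetre[of M u v] by (intro order_trans[OF G] mult_left_mono) auto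
    also have "\<dots> \<le> G * (2 powr M * jb r powr M * jb u powr (- M))"
      using that assms jb_mono[of v r] by (intro mult_left_mono mult_right_mono powr_mono2) auto
    finally show ?thesis
      by (simp add: mult_ac)
  qed
  define P where "P = G * (2 powr M * jb R powr M) * jb (x0 - ?m) powr (- M)"
  define Q where "Q = G * (2 powr M * jb (2 * R) powr M) * jb (\<eta> + ?d) powr (- M)"
  have P0: "0 \<le> P" and Q0: "0 \<le> Q"
    using assms by (auto simp: P_def Q_def)
  have inner: "norm (LINT \<xi>|lborel. wigner h f (x, \<xi>) * (gk (\<xi> - \<xi>0) * cis (- 2 * pi * \<eta> * \<xi>)))
     \<le> 4 * R * B\<^sup>2 * Q * indicator {?m - R..?m + R} x" for x
  proof -
    have "norm (LINT \<xi>|lborel. wigner h f (x, \<xi>) * (gk (\<xi> - \<xi>0) * cis (- 2 * pi * \<eta> * \<xi>)))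
      \<le> (LINT t|lborel. B\<^sup>2 * indicator {?m - R..?m + R} x * indicator {?d - 2 * R..?d + 2 * R} t * Q)"
      unfolding wigner_windowed_freq
    proof (rule norm_lint_le)
      fix t
      have "norm (h (x + t / 2) * cnj (f (x - t / 2))) * gk (- t - \<eta>)
         \<le> (B\<^sup>2 * indicator {?m - R..?m + R} x * indicator {?d - 2 * R..?d + 2 * R} t) * gk (- t - \<eta>)"
        by (intro mult_right_mono tensor_bound) simp
      also have "\<dots> \<le> B\<^sup>2 * indicator {?m - R..?m + R} x * indicator {?d - 2 * R..?d + 2 * R} t * Q"
      proof (cases "t \<in> {?d - 2 * R..?d + 2 * R}")
        case True
        have "- t - \<eta> = - ((\<eta> + ?d) + (t - ?d))" "\<bar>t - ?d\<bar> \<le> 2 * R"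
          using True by (auto simp: abs_le_iff)
        then have "gk (- t - \<eta>) \<le> Q"
          using gk_le[of "t - ?d" "2 * R" "\<eta> + ?d"] unfolding Q_def by (simp only: gk_minus)
        then show ?thesis
          by (intro mult_left_mono) auto
      qed simp
      finally show "norm (h (x + t / 2) * cnj (f (x - t / 2)) * (cis (2 * pi * \<xi>0 * (- t - \<eta>)) * gk (- t - \<eta>)))
         \<le> B\<^sup>2 * indicator {?m - R..?m + R} x * indicator {?d - 2 * R..?d + 2 * R} t * Q"
        by (simp add: norm_mult)
    qed auto
    also have "\<dots> = 4 * R * B\<^sup>2 * Q * indicator {?m - R..?m + R} x"
      using R_nonneg by simp
    finally show ?thesis .
  qed
  have "stft2 (wigner h f) ((x0, \<xi>0), (\<omega>, \<eta>)) = (LINT x|lborel. LINT \<xi>|lborel.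
     complex_of_real (sqrt 2) * gk (\<xi> - \<xi>0) * cis (- 2 * pi * \<eta> * \<xi>)
     * (wigner h f (x, \<xi>) * (gk (x - x0) * cis (- 2 * pi * \<omega> * x))))"
    unfolding stft2_wigner_eq by (rule lborel_pair.integral_fst[OF stft2_wigner_integrable, symmetric])
  also have "\<dots> = (LINT x|lborel. LINT \<xi>|lborel. complex_of_real (sqrt 2) * gk (x - x0) * cis (- 2 * pi * \<omega> * x)
     * (wigner h f (x, \<xi>) * (gk (\<xi> - \<xi>0) * cis (- 2 * pi * \<eta> * \<xi>))))"
    by (intro Bochner_Integration.integral_cong refl) (simp add: mult_ac)
  also have "\<dots> = (LINT x|lborel. complex_of_real (sqrt 2) * gk (x - x0) * cis (- 2 * pi * \<omega> * x)
     * (LINT \<xi>|lborel. wigner h f (x, \<xi>) * (gk (\<xi> - \<xi>0) * cis (- 2 * pi * \<eta> * \<xi>))))"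
    by (simp only: integral_mult_right_zero)
  finally have eq: "stft2 (wigner h f) ((x0, \<xi>0), (\<omega>, \<eta>)) = \<dots>" .
  have "norm (stft2 (wigner h f) ((x0, \<xi>0), (\<omega>, \<eta>))) \<le> (LINT x|lborel. sqrt 2 * P * (4 * R * B\<^sup>2 * Q) * indicator {?m - R..?m + R} x)"
    unfolding eq
  proof (rule norm_lint_le)
    fix x
    have "norm (complex_of_real (sqrt 2) * gk (x - x0) * cis (- 2 * pi * \<omega> * x)
     * (LINT \<xi>|lborel. wigner h f (x, \<xi>) * (gk (\<xi> - \<xi>0) * cis (- 2 * pi * \<eta> * \<xi>))))
      = sqrt 2 * gk (x - x0) * norm (LINT \<xi>|lborel. wigner h f (x, \<xi>) * (gk (\<xi> - \<xi>0) * cis (- 2 * pi * \<eta> * \<xi>)))"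
      by (simp add: norm_mult)
    also have "\<dots> \<le> sqrt 2 * gk (x - x0) * (4 * R * B\<^sup>2 * Q * indicator {?m - R..?m + R} x)"
      by (intro mult_left_mono inner) simp
    also have "\<dots> \<le> sqrt 2 * P * (4 * R * B\<^sup>2 * Q * indicator {?m - R..?m + R} x)"
    proof (cases "x \<in> {?m - R..?m + R}")
      case True
      have "x - x0 = - ((x0 - ?m) + (?m - x))" "\<bar>?m - x\<bar> \<le> R"
        using True unfolding abs_le_iff by simp_all
      then have "gk (x - x0) \<le> P"
        using gk_le[of "?m - x" R "x0 - ?m"] unfolding P_def by (simp only: gk_minus)
      then show ?thesis
        using R_nonneg Q0 by (intro mult_right_mono mult_left_mono) auto
    qed simp
    finally show "norm (complex_of_real (sqrt 2) * gk (x - x0) * cis (- 2 * pi * \<omega> * x)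
     * (LINT \<xi>|lborel. wigner h f (x, \<xi>) * (gk (\<xi> - \<xi>0) * cis (- 2 * pi * \<eta> * \<xi>))))
      \<le> sqrt 2 * P * (4 * R * B\<^sup>2 * Q) * indicator {?m - R..?m + R} x"
      by (simp add: mult_ac)
  qed auto
  also have "\<dots> = 8 * sqrt 2 * R\<^sup>2 * B\<^sup>2 * P * Q"
  proof -
    have "(LINT x|lborel. indicator {?m - R..?m + R} x) = 2 * R"
      using R_nonneg by simp
    moreover have "x * p * (4 * r * b * q) * (2 * r) = 8 * x * r\<^sup>2 * b * p * q" for x p r b q :: real
      by (simp add: power2_eq_square)
    ultimately show ?thesis
      by (simp only: integral_mult_right_zero)
  qed
  also have "\<dots> = 8 * sqrt 2 * R\<^sup>2 * B\<^sup>2 * G\<^sup>2 * (2 powr M * jb R powr M) * (2 powr M * jb (2 * R) powr M)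
      * (jb (x0 - (a + c) / 2) powr (- M) * jb (\<eta> + (a - c)) powr (- M))"
    unfolding P_def Q_def by (simp only: power2_eq_square mult_ac)
  finally show ?thesis .
qed

end

section \<open>Decay of the Fourier transform from decay of the ambiguity function\<close>

lemma Ck_imp_continuous: "Ck k f \<Longrightarrow> continuous_on UNIV f"
  by (cases k) (force simp: Ck_def continuous_on_eq_continuous_at dest: differentiable_imp_continuous_within)+

lemma ft_mult_integrable:
  fixes g :: "real \<Rightarrow> complex"
  assumes [measurable]: "g \<in> borel_measurable borel" and "\<And>t. norm (g t) \<le> B * indicator {l..u} t"
  shows "integrable lborel (\<lambda>t. g t * cis (p * t))"
proof (rule Bochner_Integration.integrable_bound)
  show "integrable lborel (\<lambda>t. B * indicator {l..u} t)"
    by auto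
  show "AE t in lborel. norm (g t * cis (p * t)) \<le> norm (B * indicator {l..u} t)"
    using assms(2) by (intro AE_I2) (auto simp: norm_mult intro: order_trans[OF _ abs_ge_self])
qed measurable

text \<open>If the transform vanished identically, so would all Gaussian averages of g around
  \<open>x0\<close>, because the Gaussian is its own Fourier transform. As the scale d tends to 0,
  these averages converge to \<open>g x0\<close>.\<close>

lemma ft_nonzero:
  fixes g :: "real \<Rightarrow> complex"
  assumes cont: "continuous_on UNIV g" and bound: "\<And>t. norm (g t) \<le> B * indicator {l..u} t"
    and "g x0 \<noteq> 0"
  shows "\<exists>q. ft g q \<noteq> 0"
proof (rule ccontr)
  assume "\<nexists>q. ft g q \<noteq> 0"
  then have ft0: "ft g q = 0" for q
    by blast
  have [measurable]: "g \<in> borel_measurable borel"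
    using cont by (rule borel_measurable_continuous_onI)
  have zero: "(LINT y|lborel. g (x0 + d * y) * gk y) = 0" if "0 < d" for d
  proof -
    let ?F = "\<lambda>y r. g (x0 + d * y) * (gk r * cis (2 * pi * r * (- y)))"
    have "(LINT y|lborel. g (x0 + d * y) * gk y) = (LINT y|lborel. LINT r|lborel. ?F y r)"
      by (simp only: integral_mult_right_zero gk_fourier gk_minus)
    also have "\<dots> = (LINT r|lborel. LINT y|lborel. ?F y r)"
    proof (rule lborel_pair.Fubini_integral[symmetric], rule integrable_lborel_pair_dominated)
      show "norm (case (y, r) of (y, r) \<Rightarrow> ?F y r) \<le> (B * indicator {l..u} (x0 + d * y)) * gk r" for y r
        using mult_right_mono[OF bound gk_nonneg] by (simp add: norm_mult)
      show "integrable lborel (\<lambda>y. B * indicator {l..u} (x0 + d * y))"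
        using \<open>0 < d\<close> by (intro lborel_integrable_real_affine integrable_mult_right) auto
    qed (auto intro: integrable_gk)
    \<comment> \<open>The substitution t = x0 + d y in \<open>ft g (r / d)\<close> shows that the
      inner integral equals this transform up to a phase and the factor 1/d.\<close>
    also have "\<dots> = (LINT r|(lborel :: real measure). 0)"
    proof (rule Bochner_Integration.integral_cong[OF refl])
      fix r
      have "0 = ft g (r / d)"
        by (simp add: ft0)
      also have "\<dots> = d *\<^sub>R (LINT y|lborel. g (x0 + d * y) * cis (- 2 * pi * (r / d) * (x0 + d * y)))"
        unfolding ft_def using \<open>0 < d\<close> by (subst lborel_integral_real_affine[of d _ x0]) auto
      also have "(LINT y|lborel. g (x0 + d * y) * cis (- 2 * pi * (r / d) * (x0 + d * y)))
        = (LINT y|lborel. cis (- 2 * pi * (r / d) * x0) * (g (x0 + d * y) * cis (2 * pi * r * (- y))))"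
      proof (rule Bochner_Integration.integral_cong[OF refl])
        fix y
        have "cis (- 2 * pi * (r / d) * (x0 + d * y)) = cis (- 2 * pi * (r / d) * x0) * cis (2 * pi * r * (- y))"
          unfolding cis_mult using \<open>0 < d\<close> by (intro arg_cong[of _ _ cis]) (simp add: field_simps)
        then show "g (x0 + d * y) * cis (- 2 * pi * (r / d) * (x0 + d * y))
          = cis (- 2 * pi * (r / d) * x0) * (g (x0 + d * y) * cis (2 * pi * r * (- y)))"
          by simp
      qed
      finally have "(LINT y|lborel. g (x0 + d * y) * cis (2 * pi * r * (- y))) = 0"
        using \<open>0 < d\<close> by (simp only: integral_mult_right_zero) simp
      moreover have "(LINT y|lborel. ?F y r) = gk r * (LINT y|lborel. g (x0 + d * y) * cis (2 * pi * r * (- y)))"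
        by (simp only: integral_mult_right_zero[symmetric] mult.left_commute)
      ultimately show "(LINT y|lborel. ?F y r) = 0"
        by simp
    qed
    finally show ?thesis
      by simp
  qed
  have "(\<lambda>n. LINT y|lborel. g (x0 + (1 / real (Suc n)) * y) * gk y) \<longlonglongrightarrow> (LINT y|lborel. g x0 * gk y)"
  proof (rule integral_dominated_convergence)
    show "integrable lborel (\<lambda>y. B * gk y)"
      by (intro integrable_mult_right integrable_gk)
    have "0 < norm (g x0)"
      using \<open>g x0 \<noteq> 0\<close> by simp
    then have "0 \<le> B"
      using bound[of x0] norm_ge_zero[of "g x0"] by (auto simp del: norm_ge_zero split: split_indicator_asm)
    then have "norm (g t) \<le> B" for t
      using bound[of t] by (auto split: split_indicator_asm)
    then show "AE y in lborel. norm (g (x0 + (1 / real (Suc n)) * y) * complex_of_real (gk y)) \<le> B * gk y" for n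
      by (intro AE_I2) (simp add: norm_mult mult_right_mono)
    show "AE y in lborel. (\<lambda>n. g (x0 + (1 / real (Suc n)) * y) * complex_of_real (gk y)) \<longlonglongrightarrow> g x0 * complex_of_real (gk y)"
    proof (rule AE_I2)
      fix y
      have "(\<lambda>n. x0 + (1 / real (Suc n)) * y) \<longlonglongrightarrow> x0 + 0 * y"
        by (intro tendsto_intros LIMSEQ_inverse_real_of_nat[unfolded inverse_eq_divide])
      moreover have "isCont g x0"
        using cont by (simp add: continuous_on_eq_continuous_at)
      ultimately have "(\<lambda>n. g (x0 + (1 / real (Suc n)) * y)) \<longlonglongrightarrow> g x0"
        by (intro isCont_tendsto_compose[of x0 g]) auto
      then show "(\<lambda>n. g (x0 + (1 / real (Suc n)) * y) * complex_of_real (gk y)) \<longlonglongrightarrow> g x0 * complex_of_real (gk y)"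
        by (intro tendsto_intros)
    qed
  qed measurable
  moreover have "(LINT y|lborel. g (x0 + (1 / real (Suc n)) * y) * gk y) = 0" for n
    by (rule zero) simp
  moreover have "(LINT y|lborel. g x0 * gk y) = g x0"
    using gk_fourier[of 0] by (simp only: integral_mult_right_zero) (simp add: gk_def)
  ultimately show False
    using \<open>g x0 \<noteq> 0\<close> LIMSEQ_unique[OF _ tendsto_const] by auto
qed

text \<open>The substitution y = t - x separates the variables and yields the product of transforms.
  For the support, t and t - x must both lie in the interval from l to u, which bounds x by its
  length.\<close>

lemma ft_mult_cnj_ft:
  fixes g :: "real \<Rightarrow> complex"
  assumes [measurable]: "g \<in> borel_measurable borel"
    and bound: "\<And>t. norm (g t) \<le> B * indicator {l..u} t"
  shows "(LINT x|lborel. stft1 g g (x, \<xi>) * cis (- 2 * pi * \<eta> * x)) = ft g (\<xi> + \<eta>) * cnj (ft g \<eta>)"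
    and "stft1 g g (x, \<xi>) \<noteq> 0 \<Longrightarrow> x \<in> {l - u..u - l}"
proof -
  have stft: "stft1 g g (x, \<xi>) = (LINT t|lborel. g t * cnj (g (t - x)) * cis (- 2 * pi * \<xi> * t))" for x
    unfolding stft1_def by (simp add: tfshift1_def cis_conv_exp exp_cnj mult_ac)
  have bound2: "norm (g t * cnj (g (t - x))) \<le> B\<^sup>2 * indicator {l - u..u - l} x * indicator {l..u} t" for x t
  proof -
    have "norm (g t * cnj (g (t - x))) \<le> (B * indicator {l..u} t) * (B * indicator {l..u} (t - x))"
      unfolding norm_mult complex_mod_cnj
      by (intro mult_mono bound order_trans[OF norm_ge_zero bound]) simp
    also have "\<dots> \<le> B\<^sup>2 * indicator {l - u..u - l} x * indicator {l..u} t"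
      by (auto simp: power2_eq_square split: split_indicator)
    finally show ?thesis .
  qed
  {
    assume nz: "stft1 g g (x, \<xi>) \<noteq> 0"
    show "x \<in> {l - u..u - l}"
    proof (rule ccontr)
      assume "x \<notin> {l - u..u - l}"
      then have "g t * cnj (g (t - x)) = 0" for t
        using bound2[of t x] by simp
      then have "stft1 g g (x, \<xi>) = 0"
        unfolding stft by (simp only: mult_zero_left) simp
      with nz show False ..
    qed
  }
  let ?F = "\<lambda>x t. g t * cnj (g (t - x)) * cis (- 2 * pi * \<xi> * t) * cis (- 2 * pi * \<eta> * x)"
  have "(LINT x|lborel. stft1 g g (x, \<xi>) * cis (- 2 * pi * \<eta> * x)) = (LINT x|lborel. LINT t|lborel. ?F x t)"
    by (simp only: stft integral_mult_left_zero)
  also have "\<dots> = (LINT t|lborel. LINT x|lborel. ?F x t)"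
  proof (rule lborel_pair.Fubini_integral[symmetric], rule integrable_lborel_pair_dominated)
    show "norm (case (x, t) of (x, t) \<Rightarrow> ?F x t) \<le> (B\<^sup>2 * indicator {l - u..u - l} x) * indicator {l..u} t" for x t
      using bound2[of t x] by (simp add: norm_mult)
  qed auto
  also have "\<dots> = (LINT t|lborel. g t * cis (- 2 * pi * (\<xi> + \<eta>) * t) * cnj (ft g \<eta>))"
  proof (rule Bochner_Integration.integral_cong[OF refl])
    fix t
    have "(LINT x|lborel. ?F x t) = (LINT y|lborel. ?F (t + - 1 * y) t)"
      by (subst lborel_integral_real_affine[of "- 1" _ t]) auto
    also have "\<dots> = (LINT y|lborel. g t * cis (- 2 * pi * (\<xi> + \<eta>) * t) * cnj (g y * cis (- 2 * pi * \<eta> * y)))"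
    proof (rule Bochner_Integration.integral_cong[OF refl])
      fix y
      have "cis (- 2 * pi * \<xi> * t) * cis (- 2 * pi * \<eta> * (t + - 1 * y))
        = cis (- 2 * pi * (\<xi> + \<eta>) * t) * cnj (cis (- 2 * pi * \<eta> * y))"
        unfolding cis_cnj cis_mult by (rule arg_cong[of _ _ cis]) (simp add: field_simps)
      then show "?F (t + - 1 * y) t = g t * cis (- 2 * pi * (\<xi> + \<eta>) * t) * cnj (g y * cis (- 2 * pi * \<eta> * y))"
        by (simp add: mult.assoc mult.left_commute)
    qed
    finally show "(LINT x|lborel. ?F x t) = g t * cis (- 2 * pi * (\<xi> + \<eta>) * t) * cnj (ft g \<eta>)"
      by (simp only: ft_def integral_mult_right_zero Bochner_Integration.integral_cnj)
  qed
  finally show "(LINT x|lborel. stft1 g g (x, \<xi>) * cis (- 2 * pi * \<eta> * x)) = ft g (\<xi> + \<eta>) * cnj (ft g \<eta>)"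
    by (simp only: ft_def integral_mult_left_zero)
qed

text \<open>Because \<open>stft1 g g\<close> has compact support in x, integrating over x costs only
  the length \<open>L\<close> and no order of decay. After division by the fixed nonzero value
  \<open>ft g \<eta>\<close>, Peetre's inequality removes the shift by \<eta>.\<close>

lemma ft_decay:
  fixes g :: "real \<Rightarrow> complex"
  assumes cont: "continuous_on UNIV g" and bound: "\<And>t. norm (g t) \<le> B * indicator {l..u} t"
    and "g x0 \<noteq> 0" and C: "\<And>z. norm (stft1 g g z) \<le> C * jb z powr (- n)" and "0 \<le> n"
  shows "\<exists>C\<ge>0. \<forall>p. norm (ft g p) \<le> C * jb p powr (- n)"
proof -
  have [measurable]: "g \<in> borel_measurable borel"
    using cont by (rule borel_measurable_continuous_onI)
  obtain \<eta> where \<eta>: "ft g \<eta> \<noteq> 0"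
    using ft_nonzero[OF cont bound \<open>g x0 \<noteq> 0\<close>] by blast
  have "0 \<le> C * jb (0::real \<times> real) powr (- n)"
    using C[of 0] norm_ge_zero order_trans by blast
  then have C0: "0 \<le> C"
    by (simp add: zero_le_mult_iff)
  define L where "L = measure lborel {l - u..u - l}"
  have prod: "norm (ft g (\<xi> + \<eta>)) * norm (ft g \<eta>) \<le> C * L * jb \<xi> powr (- n)" for \<xi>
  proof -
    have "norm (ft g (\<xi> + \<eta>)) * norm (ft g \<eta>) = norm (LINT x|lborel. stft1 g g (x, \<xi>) * cis (- 2 * pi * \<eta> * x))"
      by (simp only: ft_mult_cnj_ft(1)[OF \<open>g \<in> borel_measurable borel\<close> bound] norm_mult complex_mod_cnj)
    also have "\<dots> \<le> (LINT x|lborel. C * jb \<xi> powr (- n) * indicator {l - u..u - l} x)"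
    proof (rule norm_lint_le)
      fix x
      show "norm (stft1 g g (x, \<xi>) * cis (- 2 * pi * \<eta> * x)) \<le> C * jb \<xi> powr (- n) * indicator {l - u..u - l} x"
      proof (cases "stft1 g g (x, \<xi>) = 0")
        case True
        then show ?thesis
          using C0 by simp
      next
        case False
        have "norm (stft1 g g (x, \<xi>)) \<le> C * jb \<xi> powr (- n)"
          using C0 \<open>0 \<le> n\<close> norm_snd_le[of \<xi> x]
          by (intro order_trans[OF C] mult_left_mono jb_powr_antimono) auto
        then show ?thesis
          using ft_mult_cnj_ft(2)[OF \<open>g \<in> borel_measurable borel\<close> bound False] by (simp add: norm_mult)
      qed
    qed auto
    also have "\<dots> = C * L * jb \<xi> powr (- n)"
      by (simp add: L_def)
    finally show ?thesis .
  qed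
  have "norm (ft g p) \<le> (C * L * (2 powr n * jb \<eta> powr n) / norm (ft g \<eta>)) * jb p powr (- n)" for p
  proof -
    have "norm (ft g p) * norm (ft g \<eta>) \<le> C * L * jb (p + (- \<eta>)) powr (- n)"
      using prod[of "p - \<eta>"] by simp
    also have "\<dots> \<le> C * L * (2 powr n * jb (- \<eta>) powr n * jb p powr (- n))"
      using C0 \<open>0 \<le> n\<close> by (intro mult_left_mono peetre) (auto simp: L_def)
    finally show ?thesis
      using \<eta> by (simp add: field_simps)
  qed
  moreover have "0 \<le> C * L * (2 powr n * jb \<eta> powr n) / norm (ft g \<eta>)"
    using C0 by (simp add: L_def)
  ultimately show ?thesis
    by blast
qed

section \<open>The bell function and its local sine functions\<close>

locale bell_profile =
  fixes alpha eps :: real and zeta :: "real \<Rightarrow> real"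
  assumes alpha_pos: "0 < alpha" and eps_pos: "0 < eps" and eps_less: "eps < alpha / 2"
    and zeta_continuous: "continuous_on UNIV zeta"
    and zeta_support: "\<And>t. eps < \<bar>t\<bar> \<Longrightarrow> zeta t = 0"
    and zeta_integral: "integral UNIV zeta = pi / 2"
begin

text \<open>The support of zeta replaces the half-line by a compact interval, so that continuity of
  the indefinite integral on an interval applies to \<open>theta\<close>.\<close>

lemma theta_eq_integral_Icc:
  assumes "eps < L"
  shows "theta zeta t = integral {- L..t} zeta"
proof -
  have "(\<lambda>x. if x \<in> {..t} then zeta x else 0) = (\<lambda>x. if x \<in> {- L..t} then zeta x else 0)"
    using assms zeta_support by (auto simp: fun_eq_iff)
  then show ?thesis
    unfolding theta_def by (metis integral_restrict_UNIV)
qed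

lemma theta_left: "t < - eps \<Longrightarrow> theta zeta t = 0"
  unfolding theta_def using zeta_support eps_pos
  by (subst integral_cong[of _ _ "\<lambda>_. 0"]) auto

lemma theta_right:
  assumes "eps < t"
  shows "theta zeta t = pi / 2"
proof -
  have "(\<lambda>x. if x \<in> {..t} then zeta x else 0) = zeta"
    using assms zeta_support by (auto simp: fun_eq_iff)
  then show ?thesis
    unfolding theta_def zeta_integral[symmetric] by (metis integral_restrict_UNIV)
qed

lemma theta_continuous: "continuous_on UNIV (theta zeta)"
  unfolding continuous_on_eq_continuous_at[OF open_UNIV]
proof
  fix t0
  \<comment> \<open>This choice exceeds \<open>eps\<close>, so the compact representation of
    \<open>theta\<close> is available, and it exceeds the modulus of \<open>t0\<close>, so that
    \<open>t0\<close> is an interior point.\<close>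
  define L where "L = \<bar>t0\<bar> + eps + 1"
  have "zeta integrable_on {- L..L}"
    using zeta_continuous by (intro integrable_continuous_real) (rule continuous_on_subset, auto)
  then have "continuous_on {- L..L} (\<lambda>t. integral {- L..t} zeta)"
    by (rule indefinite_integral_continuous_1)
  moreover have "theta zeta = (\<lambda>t. integral {- L..t} zeta)"
    by (intro ext theta_eq_integral_Icc) (simp add: L_def)
  ultimately have "continuous_on {- L..L} (theta zeta)"
    by simp
  moreover have "t0 \<in> interior {- L..L}"
    using eps_pos by (auto simp: L_def)
  ultimately show "isCont (theta zeta) t0"
    by (rule continuous_on_interior)
qed

lemma bell_continuous: "continuous_on UNIV (bell alpha zeta)"
  unfolding bell_def[abs_def]
  by (intro continuous_intros continuous_on_compose2[OF theta_continuous]) auto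

text \<open>To the left of -eps the sine factor is sin 0. To the right of alpha + eps the cosine
  factor is cos (pi/2).\<close>

lemma bell_bound: "\<bar>bell alpha zeta t\<bar> \<le> indicator {- eps..alpha + eps} t"
proof (cases "t \<in> {- eps..alpha + eps}")
  case True
  have "\<bar>sin (theta zeta t)\<bar> * \<bar>cos (theta zeta (t - alpha))\<bar> \<le> 1 * 1"
    by (intro mult_mono) auto
  with True show ?thesis
    by (simp add: bell_def abs_mult)
next
  case False
  then have "t < - eps \<or> eps < t - alpha"
    by auto
  then show ?thesis
    by (auto simp: bell_def theta_left theta_right)
qed

text \<open>Since eps < alpha/2, the midpoint lies beyond the first transition of
  \<open>theta\<close> and before the second. It serves as the point of nonvanishing that
  \<open>ft_decay\<close> asks for.\<close>

lemma bell_mid: "bell alpha zeta (alpha / 2) = 1"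
proof -
  have "theta zeta (alpha / 2) = pi / 2" "theta zeta (alpha / 2 - alpha) = 0"
    using eps_less by (intro theta_right theta_left, linarith)+
  then show ?thesis
    by (simp only: bell_def) simp
qed

abbreviation cbell :: "real \<Rightarrow> complex" where
  "cbell \<equiv> \<lambda>t. complex_of_real (bell alpha zeta t)"

lemma cbell_continuous: "continuous_on UNIV cbell"
  using bell_continuous by (intro continuous_intros)

lemma cbell_measurable [measurable]: "cbell \<in> borel_measurable borel"
  by (rule borel_measurable_continuous_onI[OF cbell_continuous])

lemma bell_measurable [measurable]: "bell alpha zeta \<in> borel_measurable borel"
  by (rule borel_measurable_continuous_onI[OF bell_continuous])

lemma cbell_bound: "norm (cbell t) \<le> 1 * indicator {- eps..alpha + eps} t"
  using bell_bound[of t] by simp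

lemma psi_measurable [measurable]: "psi alpha zeta k l \<in> borel_measurable borel"
  unfolding psi_def[abs_def] by measurable

text \<open>The support interval is written by centre and radius so that it matches the locale
  \<open>compact_pair\<close>.\<close>

lemma psi_bound:
  "norm (psi alpha zeta k l t) \<le> sqrt (2 / alpha)
    * indicator {(alpha * k + alpha / 2) - (alpha / 2 + eps)..(alpha * k + alpha / 2) + (alpha / 2 + eps)} t"
proof -
  have "norm (psi alpha zeta k l t) = sqrt (2 / alpha) * (\<bar>bell alpha zeta (t - alpha * k)\<bar>
     * \<bar>sin ((2 * real l + 1) * pi / (2 * alpha) * (t - alpha * k))\<bar>)"
    using alpha_pos by (simp only: psi_def norm_of_real abs_mult) simp
  also have "\<dots> \<le> sqrt (2 / alpha) * (indicator {- eps..alpha + eps} (t - alpha * k) * 1)"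
    using alpha_pos by (intro mult_left_mono mult_mono bell_bound) auto
  also have "indicator {- eps..alpha + eps} (t - alpha * k) = (indicator {(alpha * k + alpha / 2)
      - (alpha / 2 + eps)..(alpha * k + alpha / 2) + (alpha / 2 + eps)} t :: real)"
    by (auto split: split_indicator)
  finally show ?thesis
    by simp
qed

text \<open>The sine is a difference of two exponentials with frequencies \<nu> and -\<nu>, because
  (2l + 1) pi / (2 alpha) = 2 pi \<nu>. The translation by alpha k is only a phase, so the bound
  does not depend on k.\<close>

lemma ft_psi_bound:
  fixes k :: int and l :: nat
  defines "\<nu> \<equiv> (2 * real l + 1) / (4 * alpha)"
  shows "norm (ft (psi alpha zeta k l) p) \<le> sqrt (2 / alpha) * (norm (ft cbell (p - \<nu>)) + norm (ft cbell (p + \<nu>)))"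
proof -
  let ?c = "complex_of_real (sqrt (2 / alpha))"
  have "ft (psi alpha zeta k l) p
    = (LINT t|lborel. psi alpha zeta k l (alpha * k + 1 * t) * cis (- 2 * pi * p * (alpha * k + 1 * t)))"
    unfolding ft_def by (subst lborel_integral_real_affine[of 1 _ "alpha * k"]) auto
  also have "\<dots> = (LINT t|lborel. (?c * cis (- 2 * pi * p * (alpha * k)) / (2 * \<i>)) *
      (cbell t * cis (- 2 * pi * (p - \<nu>) * t) - cbell t * cis (- 2 * pi * (p + \<nu>) * t)))"
  proof (rule Bochner_Integration.integral_cong[OF refl])
    fix t
    have "(2 * real l + 1) * pi / (2 * alpha) * t = 2 * pi * \<nu> * t"
      using alpha_pos by (simp add: \<nu>_def field_simps)
    then have 1: "psi alpha zeta k l (alpha * k + 1 * t) = ?c * cbell t * of_real (sin (2 * pi * \<nu> * t))"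
      by (simp add: psi_def)
    have 2: "complex_of_real (sin x) = (cis x - cis (- x)) / (2 * \<i>)" for x
      by (simp add: complex_eq_iff)
    have 3: "cis (2 * pi * \<nu> * t) * cis (- 2 * pi * p * (alpha * k + 1 * t))
        = cis (- 2 * pi * p * (alpha * k)) * cis (- 2 * pi * (p - \<nu>) * t)"
      "cis (- (2 * pi * \<nu> * t)) * cis (- 2 * pi * p * (alpha * k + 1 * t))
        = cis (- 2 * pi * p * (alpha * k)) * cis (- 2 * pi * (p + \<nu>) * t)"
      unfolding cis_mult by (rule arg_cong[of _ _ cis], simp add: algebra_simps)+
    have "psi alpha zeta k l (alpha * k + 1 * t) * cis (- 2 * pi * p * (alpha * k + 1 * t))
      = ?c * cbell t * ((cis (2 * pi * \<nu> * t) * cis (- 2 * pi * p * (alpha * k + 1 * t))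
        - cis (- (2 * pi * \<nu> * t)) * cis (- 2 * pi * p * (alpha * k + 1 * t))) / (2 * \<i>))"
      unfolding 1 2 by (simp add: field_simps)
    also have "\<dots> = (?c * cis (- 2 * pi * p * (alpha * k)) / (2 * \<i>)) *
      (cbell t * cis (- 2 * pi * (p - \<nu>) * t) - cbell t * cis (- 2 * pi * (p + \<nu>) * t))"
      unfolding 3 by (simp add: field_simps)
    finally show "psi alpha zeta k l (alpha * k + 1 * t) * cis (- 2 * pi * p * (alpha * k + 1 * t)) = \<dots>" .
  qed
  also have "\<dots> = (?c * cis (- 2 * pi * p * (alpha * k)) / (2 * \<i>)) * (ft cbell (p - \<nu>) - ft cbell (p + \<nu>))"
    unfolding ft_def integral_mult_right_zero
    by (subst Bochner_Integration.integral_diff) (rule ft_mult_integrable[OF cbell_measurable cbell_bound] refl)+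
  finally have "norm (ft (psi alpha zeta k l) p) = sqrt (2 / alpha) / 2 * norm (ft cbell (p - \<nu>) - ft cbell (p + \<nu>))"
    using alpha_pos by (simp only: norm_mult norm_divide norm_of_real norm_cis) (simp add: norm_mult)
  also have "\<dots> \<le> sqrt (2 / alpha) * (norm (ft cbell (p - \<nu>)) + norm (ft cbell (p + \<nu>)))"
    using alpha_pos by (intro mult_mono norm_triangle_ineq4) auto
  finally show ?thesis .
qed

end

section \<open>Integrals of products of peaks\<close>

lemma continuous_on_jb [continuous_intros]:
  "continuous_on S g \<Longrightarrow> continuous_on S (\<lambda>x. jb (g x))"
  unfolding jb_def by (intro continuous_intros)

lemma integrable_jb_powr_shift:
  assumes "1 < s"
  shows "integrable lborel (\<lambda>y::real. jb (y + A) powr (- s))"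
  using lborel_integrable_real_affine[OF integrable_jb_powr[OF assms], of 1 A] by (simp add: add.commute)

lemma nn_integral_jb_powr_shift:
  assumes "1 < s"
  shows "(\<integral>\<^sup>+ y. ennreal (jb (y + A :: real) powr (- s)) \<partial>lborel) = ennreal (LINT y|lborel. jb (y::real) powr (- s))"
proof -
  have "(\<integral>\<^sup>+ y. ennreal (jb (y + A :: real) powr (- s)) \<partial>lborel) = ennreal (LINT y|lborel. jb (y + A :: real) powr (- s))"
    using integrable_jb_powr_shift[OF assms] by (intro nn_integral_eq_integral) auto
  also have "(LINT y|lborel. jb (y + A :: real) powr (- s)) = (LINT y|lborel. jb (y::real) powr (- s))"
    by (subst (2) lborel_integral_real_affine[of 1 _ A]) (auto simp: add.commute)
  finally show ?thesis .
qed

lemma nn_integral_lborel_prod: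
  fixes F :: "'a::euclidean_space \<times> 'b::euclidean_space \<Rightarrow> ennreal"
  assumes "F \<in> borel_measurable borel"
  shows "(\<integral>\<^sup>+ z. F z \<partial>lborel) = (\<integral>\<^sup>+ y. \<integral>\<^sup>+ x. F (x, y) \<partial>lborel \<partial>lborel)"
proof -
  have "F \<in> borel_measurable (lborel \<Otimes>\<^sub>M lborel)"
    using assms by (simp add: lborel_prod)
  from lborel_pair.nn_integral_snd[OF this] show ?thesis
    by (simp add: lborel_prod)
qed

text \<open>One of the four terms that arise when the bound on the transform of the Wigner
  distribution is multiplied out, together with the weight of the symbol. Here m is the mean and d
  the difference of the positions, and A and B are signed frequencies.\<close>

definition peak :: "real \<Rightarrow> real \<Rightarrow> real \<Rightarrow> real \<Rightarrow> real \<Rightarrow> (real \<times> real) \<times> (real \<times> real) \<Rightarrow> real" where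
  "peak s m d A B Z = jb (fst (fst Z) - m) powr (- s) * jb (snd (snd Z) + d) powr (- s)
    * (jb (snd (fst Z) + fst (snd Z) / 2 - A) powr (- s) * jb (snd (fst Z) - fst (snd Z) / 2 - B) powr (- s))
    * jb (snd Z) powr (- s)"

lemma peak_nonneg [simp]: "0 \<le> peak s m d A B Z"
  by (simp add: peak_def)

lemma peak_measurable [measurable]: "peak s m d A B \<in> borel_measurable borel"
  unfolding peak_def[abs_def] by (intro borel_measurable_continuous_onI continuous_intros) auto

text \<open>\<open>jb_powr_mult_le\<close> turns the product of peaks into a sum of two translates
  of one integrable weight, with a factor in the distance A - B of the centres.\<close>

lemma nn_integral_two_peaks:
  assumes "1 < s"
  shows "(\<integral>\<^sup>+ y. ennreal (jb (y + A :: real) powr (- s) * jb (y + B) powr (- s)) \<partial>lborel)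
    \<le> ennreal (2 powr s * 2 * (LINT y|lborel. jb (y::real) powr (- s)) * jb (A - B) powr (- s))"
proof -
  let ?I = "LINT y|lborel. jb (y::real) powr (- s)"
  have I0: "0 \<le> ?I"
    by (intro integral_nonneg_AE AE_I2) simp
  have "(\<integral>\<^sup>+ y. ennreal (jb (y + A :: real) powr (- s) * jb (y + B) powr (- s)) \<partial>lborel)
    \<le> (\<integral>\<^sup>+ y. ennreal (2 powr s * jb (A - B) powr (- s))
        * (ennreal (jb (y + A) powr (- s)) + ennreal (jb (y + B) powr (- s))) \<partial>lborel)"
  proof (rule nn_integral_mono)
    fix y
    show "ennreal (jb (y + A) powr (- s) * jb (y + B) powr (- s)) \<le> ennreal (2 powr s * jb (A - B) powr (- s))
        * (ennreal (jb (y + A) powr (- s)) + ennreal (jb (y + B) powr (- s)))"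
      using jb_powr_mult_le[of s "y + A" "y + B"] assms
      by (simp add: ennreal_plus[symmetric] ennreal_mult[symmetric] ennreal_leI del: ennreal_plus)
  qed
  also have "\<dots> = ennreal (2 powr s * jb (A - B) powr (- s)) * (ennreal ?I + ennreal ?I)"
    by (subst nn_integral_cmult, measurable, subst nn_integral_add, measurable)
       (simp add: nn_integral_jb_powr_shift[OF assms])
  also have "\<dots> = ennreal (2 powr s * 2 * ?I * jb (A - B) powr (- s))"
    using I0 by (simp add: ennreal_plus[symmetric] ennreal_mult[symmetric] mult_ac del: ennreal_plus)
  finally show ?thesis .
qed

text \<open>The x-integral is a constant. In \<xi> two peaks overlap whose centres differ by
  \<omega> - (A - B), so the integral leaves a peak in \<omega> at A - B.\<close>

lemma nn_integral_peak_inner: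
  assumes "1 < s"
  shows "(\<integral>\<^sup>+ z. ennreal (peak s m d A B (z, (\<omega>, \<eta>))) \<partial>lborel)
    \<le> ennreal (2 powr s * 2 * (LINT y|lborel. jb (y::real) powr (- s))\<^sup>2
       * (jb (\<omega> - (A - B)) powr (- s) * jb (\<eta> + d) powr (- s) * jb (\<omega>, \<eta>) powr (- s)))"
proof -
  let ?I = "LINT y|lborel. jb (y::real) powr (- s)"
  let ?c = "jb (\<eta> + d) powr (- s) * jb (\<omega>, \<eta>) powr (- s)"
  let ?a = "\<lambda>\<xi>. jb (\<xi> + (\<omega> / 2 - A)) powr (- s) * jb (\<xi> + (- \<omega> / 2 - B)) powr (- s)"
  have I0: "0 \<le> ?I"
    by (intro integral_nonneg_AE AE_I2) simp
  have "(\<integral>\<^sup>+ z. ennreal (peak s m d A B (z, (\<omega>, \<eta>))) \<partial>lborel)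
    = (\<integral>\<^sup>+ \<xi>. \<integral>\<^sup>+ x. ennreal (peak s m d A B ((x, \<xi>), (\<omega>, \<eta>))) \<partial>lborel \<partial>lborel)"
    unfolding peak_def
    by (intro nn_integral_lborel_prod measurable_compose[OF _ measurable_ennreal]
        borel_measurable_continuous_onI continuous_intros) auto
  also have "\<dots> = (\<integral>\<^sup>+ \<xi>. \<integral>\<^sup>+ x. ennreal (?c * ?a \<xi>) * ennreal (jb (x + (- m)) powr (- s)) \<partial>lborel \<partial>lborel)"
  proof (intro nn_integral_cong)
    fix \<xi> x
    have e: "\<xi> + \<omega> / 2 - A = \<xi> + (\<omega> / 2 - A)" "\<xi> - \<omega> / 2 - B = \<xi> + (- \<omega> / 2 - B)" "x - m = x + (- m)"
      by simp_all
    have "peak s m d A B ((x, \<xi>), (\<omega>, \<eta>)) = ?c * ?a \<xi> * jb (x + (- m)) powr (- s)"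
      by (simp only: peak_def fst_conv snd_conv e mult_ac)
    then show "ennreal (peak s m d A B ((x, \<xi>), (\<omega>, \<eta>))) = ennreal (?c * ?a \<xi>) * ennreal (jb (x + (- m)) powr (- s))"
      by (simp only: ennreal_mult mult_nonneg_nonneg powr_ge_zero)
  qed
  also have "\<dots> = (\<integral>\<^sup>+ \<xi>. ennreal (?c * ?I) * ennreal (?a \<xi>) \<partial>lborel)"
  proof (rule nn_integral_cong)
    fix \<xi> :: real
    have "(\<integral>\<^sup>+ x. ennreal (?c * ?a \<xi>) * ennreal (jb (x + (- m)) powr (- s)) \<partial>lborel)
      = ennreal (?c * ?a \<xi>) * (\<integral>\<^sup>+ x. ennreal (jb (x + (- m)) powr (- s)) \<partial>lborel)"
      by (rule nn_integral_cmult) measurable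
    also have "\<dots> = ennreal (?c * ?a \<xi>) * ennreal ?I"
      by (simp only: nn_integral_jb_powr_shift[OF assms])
    also have "\<dots> = ennreal ((?c * ?a \<xi>) * ?I)"
      using I0 by (intro ennreal_mult[symmetric]) auto
    also have "(?c * ?a \<xi>) * ?I = (?c * ?I) * ?a \<xi>"
      by (simp only: mult_ac)
    also have "ennreal \<dots> = ennreal (?c * ?I) * ennreal (?a \<xi>)"
      using I0 by (intro ennreal_mult) auto
    finally show "(\<integral>\<^sup>+ x. ennreal (?c * ?a \<xi>) * ennreal (jb (x + (- m)) powr (- s)) \<partial>lborel)
      = ennreal (?c * ?I) * ennreal (?a \<xi>)" .
  qed
  also have "\<dots> = ennreal (?c * ?I) * (\<integral>\<^sup>+ \<xi>. ennreal (?a \<xi>) \<partial>lborel)"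
    by (rule nn_integral_cmult) measurable
  also have "\<dots> \<le> ennreal (?c * ?I) * ennreal (2 powr s * 2 * ?I * jb ((\<omega> / 2 - A) - (- \<omega> / 2 - B)) powr (- s))"
    by (intro mult_left_mono nn_integral_two_peaks assms) simp
  also have "\<dots> = ennreal (2 powr s * 2 * ?I\<^sup>2
       * (jb (\<omega> - (A - B)) powr (- s) * jb (\<eta> + d) powr (- s) * jb (\<omega>, \<eta>) powr (- s)))"
  proof -
    have "(\<omega> / 2 - A) - (- \<omega> / 2 - B) = \<omega> - (A - B)"
      by (simp add: field_simps)
    then have "(?c * ?I) * (2 powr s * 2 * ?I * jb ((\<omega> / 2 - A) - (- \<omega> / 2 - B)) powr (- s))
      = 2 powr s * 2 * ?I\<^sup>2 * (jb (\<omega> - (A - B)) powr (- s) * jb (\<eta> + d) powr (- s) * jb (\<omega>, \<eta>) powr (- s))"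
      by (simp only: power2_eq_square mult_ac)
    then show ?thesis
      using I0 by (subst ennreal_mult[symmetric]) auto
  qed
  finally show ?thesis .
qed

text \<open>Splitting the weight on the plane into one-variable weights halves the exponent.
  Integrability of each factor then amounts to s/2 > 1.\<close>

lemma jb_Pair_powr_le:
  assumes "0 \<le> s"
  shows "jb (x, y) powr (- s) \<le> jb x powr (- (s / 2)) * jb y powr (- (s / 2))"
proof -
  have "jb x powr (s / 2) * jb y powr (s / 2) = (jb x * jb y) powr (s / 2)"
    by (simp add: powr_mult)
  also have "\<dots> \<le> ((jb (x, y))\<^sup>2) powr (s / 2)"
    using assms by (intro powr_mono2 jb_mult_le_Pair_sq) auto
  also have "\<dots> = jb (x, y) powr s"
    by (simp add: powr_powr flip: powr_numeral)
  finally show ?thesis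
    by (simp add: powr_minus divide_simps)
qed

lemma nn_integral_jb_tensor:
  assumes "1 < s"
  shows "(\<integral>\<^sup>+ \<zeta>. ennreal (jb (fst \<zeta> + a :: real) powr (- s) * jb (snd \<zeta> + b :: real) powr (- s)) \<partial>lborel)
    = ennreal ((LINT y|lborel. jb (y::real) powr (- s))\<^sup>2)"
proof -
  let ?I = "LINT y|lborel. jb (y::real) powr (- s)"
  have I0: "0 \<le> ?I"
    by (intro integral_nonneg_AE AE_I2) simp
  have "(\<lambda>\<zeta>::real \<times> real. jb (fst \<zeta> + a) powr (- s) * jb (snd \<zeta> + b) powr (- s)) \<in> borel_measurable borel"
    by (intro borel_measurable_continuous_onI continuous_intros) auto
  then have "(\<integral>\<^sup>+ \<zeta>. ennreal (jb (fst \<zeta> + a :: real) powr (- s) * jb (snd \<zeta> + b :: real) powr (- s)) \<partial>lborel)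
    = (\<integral>\<^sup>+ y. \<integral>\<^sup>+ x. ennreal (jb (x + a :: real) powr (- s) * jb (y + b :: real) powr (- s)) \<partial>lborel \<partial>lborel)"
    by (subst nn_integral_lborel_prod) simp_all
  also have "\<dots> = (\<integral>\<^sup>+ y. ennreal ?I * ennreal (jb (y + b :: real) powr (- s)) \<partial>lborel)"
    unfolding ennreal_mult[OF powr_ge_zero powr_ge_zero]
    by (subst nn_integral_multc) (simp_all only: nn_integral_jb_powr_shift[OF assms], measurable)
  also have "\<dots> = ennreal ?I * ennreal ?I"
    by (subst nn_integral_cmult) (simp_all only: nn_integral_jb_powr_shift[OF assms], measurable)
  finally show ?thesis
    using I0 by (simp only: power2_eq_square ennreal_mult)
qed

text \<open>After integration over position and frequency, what remains is a peak at (A - B, -d)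
  times the symbol's weight, centred at the origin. By \<open>jb_powr_mult_le\<close> on the plane,
  the distance of these centres gives the decay, and the leftover sum of weights is integrable
  because s > 2.\<close>

lemma nn_integral_peak:
  assumes "2 < s"
  shows "\<exists>K\<ge>0. \<forall>m d A B. (\<integral>\<^sup>+ Z. ennreal (peak s m d A B Z) \<partial>lborel) \<le> ennreal (K * jb (d, A - B) powr (- s))"
proof -
  let ?I = "LINT y|lborel. jb (y::real) powr (- s)"
  let ?J = "LINT y|lborel. jb (y::real) powr (- (s / 2))"
  have s1: "1 < s" "1 < s / 2"
    using assms by auto
  have J0: "0 \<le> ?J"
    by (intro integral_nonneg_AE AE_I2) simp
  \<comment> \<open>The first factors come from \<open>nn_integral_peak_inner\<close>; the last
    \<open>2 powr s\<close> comes from the second use of \<open>jb_powr_mult_le\<close>.\<close>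
  define L where "L = 2 powr s * 2 * ?I\<^sup>2 * 2 powr s"
  have L0: "0 \<le> L"
    by (simp add: L_def)
  have "(\<integral>\<^sup>+ Z. ennreal (peak s m d A B Z) \<partial>lborel) \<le> ennreal (L * (2 * ?J\<^sup>2) * jb (d, A - B) powr (- s))" for m d A B
  proof -
    let ?w = "jb (d, A - B) powr (- s)"
    let ?\<phi> = "\<lambda>t y. ennreal (jb (y + t) powr (- (s / 2)))"
    have pt: "jb (\<omega> - (A - B)) powr (- s) * jb (\<eta> + d) powr (- s) * jb (\<omega>, \<eta>) powr (- s)
       \<le> 2 powr s * ?w * (jb \<omega> powr (- (s / 2)) * jb \<eta> powr (- (s / 2))
           + jb (\<omega> - (A - B)) powr (- (s / 2)) * jb (\<eta> + d) powr (- (s / 2)))" for \<omega> \<eta>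
    proof -
      let ?v = "(\<omega> - (A - B), \<eta> + d)"
      have "jb (\<omega> - (A - B)) powr (- s) * jb (\<eta> + d) powr (- s) = (jb (\<omega> - (A - B)) * jb (\<eta> + d)) powr (- s)"
        by (simp add: powr_mult)
      also have "\<dots> \<le> jb ?v powr (- s)"
        using assms by (intro powr_mono2' jb_Pair_le_mult) auto
      finally have "jb (\<omega> - (A - B)) powr (- s) * jb (\<eta> + d) powr (- s) * jb (\<omega>, \<eta>) powr (- s)
         \<le> jb ?v powr (- s) * jb (\<omega>, \<eta>) powr (- s)"
        by (intro mult_right_mono) auto
      also have "\<dots> = jb (\<omega>, \<eta>) powr (- s) * jb ?v powr (- s)"
        by simp
      also have "\<dots> \<le> 2 powr s * jb ((\<omega>, \<eta>) - ?v) powr (- s) * (jb (\<omega>, \<eta>) powr (- s) + jb ?v powr (- s))"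
        using assms by (intro jb_powr_mult_le) auto
      also have "\<dots> \<le> 2 powr s * jb ((\<omega>, \<eta>) - ?v) powr (- s) * (jb \<omega> powr (- (s / 2)) * jb \<eta> powr (- (s / 2))
           + jb (\<omega> - (A - B)) powr (- (s / 2)) * jb (\<eta> + d) powr (- (s / 2)))"
        using assms by (intro mult_left_mono add_mono jb_Pair_powr_le) auto
      \<comment> \<open>The difference is (A - B, -d), and the norm ignores the sign and the order
        of the coordinates.\<close>
      also have "jb ((\<omega>, \<eta>) - ?v) = jb (d, A - B)"
        by (simp add: jb_def norm_Pair add.commute)
      finally show ?thesis .
    qed
    have "(\<integral>\<^sup>+ Z. ennreal (peak s m d A B Z) \<partial>lborel)
      = (\<integral>\<^sup>+ \<zeta>. \<integral>\<^sup>+ z. ennreal (peak s m d A B (z, \<zeta>)) \<partial>lborel \<partial>lborel)"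
      by (rule nn_integral_lborel_prod) measurable
    also have "\<dots> \<le> (\<integral>\<^sup>+ \<zeta>. ennreal (L * ?w * (jb (fst \<zeta>) powr (- (s / 2)) * jb (snd \<zeta>) powr (- (s / 2))
           + jb (fst \<zeta> - (A - B)) powr (- (s / 2)) * jb (snd \<zeta> + d) powr (- (s / 2)))) \<partial>lborel)"
    proof (rule nn_integral_mono)
      fix \<zeta> :: "real \<times> real"
      obtain \<omega> \<eta> where \<zeta>: "\<zeta> = (\<omega>, \<eta>)"
        by fastforce
      have "2 powr s * 2 * ?I\<^sup>2 * (jb (\<omega> - (A - B)) powr (- s) * jb (\<eta> + d) powr (- s) * jb (\<omega>, \<eta>) powr (- s))
       \<le> 2 powr s * 2 * ?I\<^sup>2 * (2 powr s * ?w * (jb \<omega> powr (- (s / 2)) * jb \<eta> powr (- (s / 2))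
           + jb (\<omega> - (A - B)) powr (- (s / 2)) * jb (\<eta> + d) powr (- (s / 2))))"
        by (intro mult_left_mono pt) simp
      also have "\<dots> = L * ?w * (jb \<omega> powr (- (s / 2)) * jb \<eta> powr (- (s / 2))
           + jb (\<omega> - (A - B)) powr (- (s / 2)) * jb (\<eta> + d) powr (- (s / 2)))"
        by (simp only: L_def mult.assoc)
      finally show "(\<integral>\<^sup>+ z. ennreal (peak s m d A B (z, \<zeta>)) \<partial>lborel)
        \<le> ennreal (L * ?w * (jb (fst \<zeta>) powr (- (s / 2)) * jb (snd \<zeta>) powr (- (s / 2))
           + jb (fst \<zeta> - (A - B)) powr (- (s / 2)) * jb (snd \<zeta> + d) powr (- (s / 2))))"
        unfolding \<zeta> fst_conv snd_conv
        by (intro order_trans[OF nn_integral_peak_inner[OF s1(1)]] ennreal_leI)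
    qed
    finally have le: "(\<integral>\<^sup>+ Z. ennreal (peak s m d A B Z) \<partial>lborel) \<le> \<dots>" .
    let ?f = "\<lambda>a b \<zeta>. jb (fst \<zeta> + a :: real) powr (- (s / 2)) * jb (snd \<zeta> + b :: real) powr (- (s / 2))"
    have [measurable]: "?f a b \<in> borel_measurable borel" for a b
      by (intro borel_measurable_continuous_onI continuous_intros) auto
    have "ennreal (L * ?w * (jb (fst \<zeta>) powr (- (s / 2)) * jb (snd \<zeta>) powr (- (s / 2))
           + jb (fst \<zeta> - (A - B)) powr (- (s / 2)) * jb (snd \<zeta> + d) powr (- (s / 2))))
      = ennreal (L * ?w) * (ennreal (?f 0 0 \<zeta>) + ennreal (?f (- (A - B)) d \<zeta>))" for \<zeta>
    proof -
      have "fst \<zeta> + - (A - B) = fst \<zeta> - (A - B)"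
        by simp
      then show ?thesis
        using L0 by (simp only:) (subst ennreal_plus[symmetric], simp, simp, subst ennreal_mult[symmetric], auto)
    qed
    then have "(\<integral>\<^sup>+ Z. ennreal (peak s m d A B Z) \<partial>lborel)
      \<le> (\<integral>\<^sup>+ \<zeta>. ennreal (L * ?w) * (ennreal (?f 0 0 \<zeta>) + ennreal (?f (- (A - B)) d \<zeta>)) \<partial>lborel)"
      using le by (simp only:)
    moreover have "(\<integral>\<^sup>+ \<zeta>. ennreal (L * ?w) * (ennreal (?f 0 0 \<zeta>) + ennreal (?f (- (A - B)) d \<zeta>)) \<partial>lborel)
      = ennreal (L * ?w) * (\<integral>\<^sup>+ \<zeta>. ennreal (?f 0 0 \<zeta>) + ennreal (?f (- (A - B)) d \<zeta>) \<partial>lborel)"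
      by (rule nn_integral_cmult) measurable
    moreover have "(\<integral>\<^sup>+ \<zeta>. ennreal (?f 0 0 \<zeta>) + ennreal (?f (- (A - B)) d \<zeta>) \<partial>lborel) = ennreal (?J\<^sup>2) + ennreal (?J\<^sup>2)"
      by (subst nn_integral_add, measurable) (simp only: nn_integral_jb_tensor[OF s1(2)])
    moreover have "ennreal (L * ?w) * (ennreal (?J\<^sup>2) + ennreal (?J\<^sup>2)) = ennreal (L * (2 * ?J\<^sup>2) * ?w)"
    proof -
      have "ennreal (?J\<^sup>2) + ennreal (?J\<^sup>2) = ennreal (2 * ?J\<^sup>2)"
        by (subst ennreal_plus[symmetric]) auto
      moreover have "ennreal (L * ?w) * ennreal (2 * ?J\<^sup>2) = ennreal (L * ?w * (2 * ?J\<^sup>2))"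
        using L0 by (intro ennreal_mult[symmetric]) auto
      moreover have "L * ?w * (2 * ?J\<^sup>2) = L * (2 * ?J\<^sup>2) * ?w"
        by (simp only: mult_ac)
      ultimately show ?thesis
        by (simp only:)
    qed
    ultimately show ?thesis
      by (simp only:)
  qed
  moreover have "0 \<le> L * (2 * ?J\<^sup>2)"
    using L0 by simp
  ultimately show ?thesis
    by blast
qed

section \<open>Interpolation of the two bounds and the estimate of the matrix entries\<close>

lemma powr_interpolate:
  fixes v p q t :: real
  assumes "0 \<le> v" "v \<le> p" "v \<le> q" "0 < t" "t < 1"
  shows "v \<le> p powr (1 - t) * q powr t"
proof -
  have "v = v powr (1 - t) * v powr t"
    using assms powr_add[of v "1 - t" t] by simp
  also have "\<dots> \<le> p powr (1 - t) * q powr t"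
    using assms by (intro mult_mono powr_mono2) auto
  finally show ?thesis .
qed

lemma powr_add_le:
  fixes x y t :: real
  assumes "0 \<le> x" "0 \<le> y" "0 \<le> t"
  shows "(x + y) powr t \<le> 2 powr t * (x powr t + y powr t)"
proof -
  have "(x + y) powr t \<le> (2 * max x y) powr t"
    using assms by (intro powr_mono2) auto
  also have "\<dots> = 2 powr t * max x y powr t"
    using assms by (simp add: powr_mult)
  also have "\<dots> \<le> 2 powr t * (x powr t + y powr t)"
    by (intro mult_left_mono) (auto simp: max_def)
  finally show ?thesis .
qed

text \<open>A nonintegrable \<open>F\<close> has integral 0 by convention. The pairing with a symbol
  can thus be estimated from a pointwise bound on \<open>dstft T\<close>.\<close>

lemma norm_integral_le_nn_integral:
  fixes F :: "'a \<Rightarrow> 'b::{banach, second_countable_topology}"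
  shows "ennreal (norm (integral\<^sup>L M F)) \<le> (\<integral>\<^sup>+ x. ennreal (norm (F x)) \<partial>M)"
  by (cases "integrable M F") (auto simp: integral_norm_bound_ennreal not_integrable_integral_eq)

context bell_profile
begin

lemma stft2_wigner_psi_bound:
  assumes s: "0 < s" "s < n"
    and C: "0 \<le> C" "\<And>p. norm (ft cbell p) \<le> C * jb p powr (- n)"
  shows "\<exists>K\<ge>0. \<forall>k k' l l' x0 \<xi>0 \<omega> \<eta>. norm (stft2 (wigner (psi alpha zeta k l) (psi alpha zeta k' l')) ((x0, \<xi>0), (\<omega>, \<eta>)))
    \<le> K * (jb (x0 - (alpha * k + alpha * k' + alpha) / 2) powr (- s) * jb (\<eta> + alpha * (k - k')) powr (- s)
      * ((jb (\<xi>0 + \<omega> / 2 - (2 * real l + 1) / (4 * alpha)) powr (- s) + jb (\<xi>0 + \<omega> / 2 + (2 * real l + 1) / (4 * alpha)) powr (- s))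
       * (jb (\<xi>0 - \<omega> / 2 - (2 * real l' + 1) / (4 * alpha)) powr (- s) + jb (\<xi>0 - \<omega> / 2 + (2 * real l' + 1) / (4 * alpha)) powr (- s))))"
proof -
  \<comment> \<open>The frequency bound enters with weight t and the space bound with weight 1 - t.
    Taking t = s/n reduces order n to s, and t < 1 because s < n. The space bound is available at
    any order, so M is chosen to be reduced to s by the power 1 - t.\<close>
  define t where "t = s / n"
  have t: "0 < t" "t < 1" "n * t = s"
    using s by (auto simp: t_def)
  define M where "M = s / (1 - t)"
  have M: "0 \<le> M" "M * (1 - t) = s"
    using s t by (auto simp: M_def)
  obtain G where G: "0 \<le> G" "\<And>x. gk x \<le> G * jb x powr (- M)"
    using gk_le_jb_powr by metis
  define B where "B = sqrt (2 / alpha)"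
  define R where "R = alpha / 2 + eps"
  define c where "c = B * C"
  define K1 where "K1 = 8 * sqrt 2 * R\<^sup>2 * B\<^sup>2 * G\<^sup>2 * (2 powr M * jb R powr M) * (2 powr M * jb (2 * R) powr M)"
  define K2 where "K2 = sqrt 2 * (2 powr n) ^ 4 * (LINT r|lborel. gk r * jb r powr (2 * n))\<^sup>2"
  \<comment> \<open>Each factor \<open>2 powr t\<close> pays for distributing the power t over a sum
    of two frequency peaks, as in \<open>powr_add_le\<close>.\<close>
  define K where "K = K1 powr (1 - t) * (K2 * c\<^sup>2) powr t * (2 powr t * 2 powr t)"
  have B0: "0 \<le> B" and R0: "0 \<le> R" and n0: "0 \<le> n" and c0: "0 \<le> c"
    using alpha_pos eps_pos s C by (auto simp: B_def R_def c_def)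
  have K10: "0 \<le> K1" and K20: "0 \<le> K2"
    using B0 R0 G by (auto simp: K1_def K2_def)
  let ?H = "\<lambda>\<nu> p. c * (jb (p - \<nu>) powr (- n) + jb (p + \<nu>) powr (- n))"
  let ?h = "\<lambda>\<nu> p. jb (p - \<nu>) powr (- s) + jb (p + \<nu>) powr (- s)"
  \<comment> \<open>Peetre's inequality makes the majorant moderate with constant
    \<open>2 powr n\<close>, as \<open>stft2_wigner_bound_freq\<close> demands.\<close>
  have H_mod: "?H \<nu> (p + y) \<le> 2 powr n * jb y powr n * ?H \<nu> p" for \<nu> p y :: real
  proof -
    have "jb (p + y - \<nu>) powr (- n) \<le> 2 powr n * jb y powr n * jb (p - \<nu>) powr (- n)"
      using peetre[OF n0, of "p - \<nu>" y] by (simp add: algebra_simps)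
    moreover have "jb (p + y + \<nu>) powr (- n) \<le> 2 powr n * jb y powr n * jb (p + \<nu>) powr (- n)"
      using peetre[OF n0, of "p + \<nu>" y] by (simp add: add_ac)
    ultimately have "c * (jb (p + y - \<nu>) powr (- n) + jb (p + y + \<nu>) powr (- n))
      \<le> c * (2 powr n * jb y powr n * jb (p - \<nu>) powr (- n) + 2 powr n * jb y powr n * jb (p + \<nu>) powr (- n))"
      using c0 by (intro mult_left_mono add_mono) auto
    then show ?thesis
      by (simp add: algebra_simps)
  qed
  have ft_le: "norm (ft (psi alpha zeta k l) p) \<le> ?H ((2 * real l + 1) / (4 * alpha)) p" for k l p
  proof -
    let ?\<nu> = "(2 * real l + 1) / (4 * alpha)"
    have "norm (ft (psi alpha zeta k l) p) \<le> B * (norm (ft cbell (p - ?\<nu>)) + norm (ft cbell (p + ?\<nu>)))"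
      unfolding B_def by (rule ft_psi_bound)
    also have "\<dots> \<le> B * (C * jb (p - ?\<nu>) powr (- n) + C * jb (p + ?\<nu>) powr (- n))"
      using B0 by (intro mult_left_mono add_mono C)
    finally show ?thesis
      by (simp add: c_def algebra_simps)
  qed
  have H_powr: "(jb (p - \<nu>) powr (- n) + jb (p + \<nu>) powr (- n)) powr t \<le> 2 powr t * ?h \<nu> p" for \<nu> p :: real
    using powr_add_le[of "jb (p - \<nu>) powr (- n)" "jb (p + \<nu>) powr (- n)" t] t by (simp add: powr_powr)
  have "norm (stft2 (wigner (psi alpha zeta k l) (psi alpha zeta k' l')) ((x0, \<xi>0), (\<omega>, \<eta>)))
    \<le> K * (jb (x0 - (alpha * k + alpha * k' + alpha) / 2) powr (- s) * jb (\<eta> + alpha * (k - k')) powr (- s)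
      * (?h ((2 * real l + 1) / (4 * alpha)) (\<xi>0 + \<omega> / 2) * ?h ((2 * real l' + 1) / (4 * alpha)) (\<xi>0 - \<omega> / 2)))"
    (is "norm ?V \<le> _") for k k' :: int and l l' :: nat and x0 \<xi>0 \<omega> \<eta> :: real
  proof -
    interpret compact_pair "psi alpha zeta k l" "psi alpha zeta k' l'"
      "alpha * k + alpha / 2" "alpha * k' + alpha / 2" B R
      by unfold_locales (use psi_bound B0 R0 in \<open>auto simp: B_def R_def\<close>)
    define \<nu> where "\<nu> = (2 * real l + 1) / (4 * alpha)"
    define \<nu>' where "\<nu>' = (2 * real l' + 1) / (4 * alpha)"
    define X where "X = jb (x0 - (alpha * k + alpha * k' + alpha) / 2)"
    define Y where "Y = jb (\<eta> + alpha * (k - k'))"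
    define P where "P = jb (\<xi>0 + \<omega> / 2 - \<nu>) powr (- n) + jb (\<xi>0 + \<omega> / 2 + \<nu>) powr (- n)"
    define Q where "Q = jb (\<xi>0 - \<omega> / 2 - \<nu>') powr (- n) + jb (\<xi>0 - \<omega> / 2 + \<nu>') powr (- n)"
    have XY: "0 < X" "0 < Y" and PQ: "0 \<le> P" "0 \<le> Q"
      by (auto simp: X_def Y_def P_def Q_def)
    have e: "(alpha * k + alpha / 2 + (alpha * k' + alpha / 2)) / 2 = (alpha * k + alpha * k' + alpha) / 2"
      "alpha * k + alpha / 2 - (alpha * k' + alpha / 2) = alpha * (k - k')"
      by (simp_all add: algebra_simps)
    have 1: "norm ?V \<le> K1 * (X powr (- M) * Y powr (- M))"
      using stft2_wigner_bound_space[OF G(2) M(1) G(1)] unfolding K1_def X_def Y_def e .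
    have "norm ?V \<le> K2 * (?H \<nu> (\<xi>0 + \<omega> / 2) * ?H \<nu>' (\<xi>0 - \<omega> / 2))"
      unfolding K2_def \<nu>_def \<nu>'_def
      by (rule stft2_wigner_bound_freq[OF ft_le ft_le H_mod H_mod n0]) simp
    then have 2: "norm ?V \<le> K2 * c\<^sup>2 * (P * Q)"
      unfolding P_def Q_def by (simp only: power2_eq_square mult_ac)
    have "norm ?V \<le> (K1 * (X powr (- M) * Y powr (- M))) powr (1 - t) * (K2 * c\<^sup>2 * (P * Q)) powr t"
      using t by (intro powr_interpolate 1 2) auto
    also have "(K1 * (X powr (- M) * Y powr (- M))) powr (1 - t)
      = K1 powr (1 - t) * (X powr (- s) * Y powr (- s))"
      using K10 M(2) by (simp add: powr_mult powr_powr)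
    also have "(K2 * c\<^sup>2 * (P * Q)) powr t = (K2 * c\<^sup>2) powr t * (P powr t * Q powr t)"
      using K20 PQ by (simp add: powr_mult)
    also have "K1 powr (1 - t) * (X powr (- s) * Y powr (- s)) * ((K2 * c\<^sup>2) powr t * (P powr t * Q powr t))
      \<le> K1 powr (1 - t) * (X powr (- s) * Y powr (- s)) * ((K2 * c\<^sup>2) powr t
         * ((2 powr t * ?h \<nu> (\<xi>0 + \<omega> / 2)) * (2 powr t * ?h \<nu>' (\<xi>0 - \<omega> / 2))))"
      unfolding P_def Q_def by (intro mult_left_mono mult_mono H_powr) auto
    also have "\<dots> = K * (X powr (- s) * Y powr (- s) * (?h \<nu> (\<xi>0 + \<omega> / 2) * ?h \<nu>' (\<xi>0 - \<omega> / 2)))"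
      unfolding K_def by (simp only: mult_ac)
    finally show ?thesis
      unfolding X_def Y_def \<nu>_def \<nu>'_def .
  qed
  moreover have "0 \<le> K"
    by (simp add: K_def)
  ultimately show ?thesis
    by blast
qed

text \<open>Multiplying out the two sums of frequency peaks gives four instances of
  \<open>peak\<close>, with signed frequencies \<nu> or -\<nu> and \<nu>' or -\<nu>'. Equal signs
  produce decay in l - l', opposite signs decay in l + l'.\<close>

lemma weyl_form_psi_bound:
  assumes s: "2 < s" "s < n"
    and C: "\<And>z. norm (stft1 cbell cbell z) \<le> C * jb z powr (- n)"
    and T: "\<And>z \<zeta>. cmod (dstft T (z, \<zeta>)) * jb \<zeta> powr s \<le> D"
  shows "\<exists>Cs. \<forall>k k' :: int. \<forall>l l' :: nat.
     cmod (weyl_form T (psi alpha zeta k' l') (psi alpha zeta k l))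
       \<le> Cs * (jb (alpha * of_int (k - k'), (real l - real l') / (2 * alpha)) powr (- s)
              + jb (alpha * of_int (k - k'), (real l + real l') / (2 * alpha)) powr (- s))"
proof -
  have n0: "0 \<le> n" and s0: "0 < s"
    using s by auto
  have nz: "cbell (alpha / 2) \<noteq> 0"
    by (simp only: bell_mid) simp
  obtain C' where C': "0 \<le> C'" "\<And>p. norm (ft cbell p) \<le> C' * jb p powr (- n)"
    using ft_decay[OF cbell_continuous cbell_bound nz C n0] by blast
  obtain K where K: "0 \<le> K" "\<And>k k' l l' x0 \<xi>0 \<omega> \<eta>. norm (stft2 (wigner (psi alpha zeta k l) (psi alpha zeta k' l')) ((x0, \<xi>0), (\<omega>, \<eta>)))
    \<le> K * (jb (x0 - (alpha * k + alpha * k' + alpha) / 2) powr (- s) * jb (\<eta> + alpha * (k - k')) powr (- s)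
      * ((jb (\<xi>0 + \<omega> / 2 - (2 * real l + 1) / (4 * alpha)) powr (- s) + jb (\<xi>0 + \<omega> / 2 + (2 * real l + 1) / (4 * alpha)) powr (- s))
       * (jb (\<xi>0 - \<omega> / 2 - (2 * real l' + 1) / (4 * alpha)) powr (- s) + jb (\<xi>0 - \<omega> / 2 + (2 * real l' + 1) / (4 * alpha)) powr (- s))))"
    using stft2_wigner_psi_bound[OF s0 s(2) C'] by blast
  obtain L where L: "0 \<le> L" "\<And>m d A B. (\<integral>\<^sup>+ Z. ennreal (peak s m d A B Z) \<partial>lborel) \<le> ennreal (L * jb (d, A - B) powr (- s))"
    using nn_integral_peak[OF s(1)] by blast
  have "0 \<le> cmod (dstft T (0, 0)) * jb (0 :: real \<times> real) powr s"
    by simp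
  then have D0: "0 \<le> D"
    using T order_trans by blast
  have T': "cmod (dstft T (z, \<zeta>)) \<le> D * jb \<zeta> powr (- s)" for z \<zeta>
    using T[of z \<zeta>] by (simp add: powr_minus divide_simps)
  have "cmod (weyl_form T (psi alpha zeta k' l') (psi alpha zeta k l))
       \<le> (D * K * L * 2) * (jb (alpha * of_int (k - k'), (real l - real l') / (2 * alpha)) powr (- s)
              + jb (alpha * of_int (k - k'), (real l + real l') / (2 * alpha)) powr (- s))"
    for k k' :: int and l l' :: nat
  proof -
    define \<nu> where "\<nu> = (2 * real l + 1) / (4 * alpha)"
    define \<nu>' where "\<nu>' = (2 * real l' + 1) / (4 * alpha)"
    define m where "m = (alpha * k + alpha * k' + alpha) / 2"
    define d where "d = alpha * real_of_int (k - k')"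
    let ?p = "\<lambda>A B Z. peak s m d A B Z"
    let ?j = "\<lambda>A B. jb (d, A - B) powr (- s)"
    let ?V = "stft2 (wigner (psi alpha zeta k l) (psi alpha zeta k' l'))"
    have pt: "norm (dstft T Z * cnj (?V Z)) \<le> D * K * (?p \<nu> \<nu>' Z + ?p \<nu> (- \<nu>') Z + ?p (- \<nu>) \<nu>' Z + ?p (- \<nu>) (- \<nu>') Z)" for Z
    proof -
      obtain x0 \<xi>0 \<omega> \<eta> where Z: "Z = ((x0, \<xi>0), (\<omega>, \<eta>))"
        by (metis surj_pair)
      have "norm (dstft T Z * cnj (?V Z)) \<le> (D * jb (\<omega>, \<eta>) powr (- s)) *
        (K * (jb (x0 - m) powr (- s) * jb (\<eta> + d) powr (- s)
      * ((jb (\<xi>0 + \<omega> / 2 - \<nu>) powr (- s) + jb (\<xi>0 + \<omega> / 2 + \<nu>) powr (- s))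
       * (jb (\<xi>0 - \<omega> / 2 - \<nu>') powr (- s) + jb (\<xi>0 - \<omega> / 2 + \<nu>') powr (- s)))))"
        unfolding norm_mult complex_mod_cnj Z m_def d_def \<nu>_def \<nu>'_def
        using D0 by (intro mult_mono T' K(2)) auto
      also have "\<dots> = D * K * (?p \<nu> \<nu>' Z + ?p \<nu> (- \<nu>') Z + ?p (- \<nu>) \<nu>' Z + ?p (- \<nu>) (- \<nu>') Z)"
        unfolding peak_def Z fst_conv snd_conv diff_minus_eq_add
        by (simp only: distrib_left distrib_right mult_ac add_ac)
      finally show ?thesis .
    qed
    have "ennreal (cmod (weyl_form T (psi alpha zeta k' l') (psi alpha zeta k l)))
      \<le> (\<integral>\<^sup>+ Z. ennreal (norm (dstft T Z * cnj (?V Z))) \<partial>lborel)"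
      unfolding weyl_form_def dpair_def by (rule norm_integral_le_nn_integral)
    also have "\<dots> \<le> (\<integral>\<^sup>+ Z. ennreal (D * K) * (ennreal (?p \<nu> \<nu>' Z) + ennreal (?p \<nu> (- \<nu>') Z)
        + ennreal (?p (- \<nu>) \<nu>' Z) + ennreal (?p (- \<nu>) (- \<nu>') Z)) \<partial>lborel)"
    proof (rule nn_integral_mono)
      fix Z
      show "ennreal (norm (dstft T Z * cnj (?V Z))) \<le> ennreal (D * K) * (ennreal (?p \<nu> \<nu>' Z) + ennreal (?p \<nu> (- \<nu>') Z)
        + ennreal (?p (- \<nu>) \<nu>' Z) + ennreal (?p (- \<nu>) (- \<nu>') Z))"
        using ennreal_leI[OF pt[of Z]] D0 K(1) by (simp add: ennreal_mult)
    qed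
    also have "\<dots> = ennreal (D * K) * ((\<integral>\<^sup>+ Z. ennreal (?p \<nu> \<nu>' Z) \<partial>lborel) + (\<integral>\<^sup>+ Z. ennreal (?p \<nu> (- \<nu>') Z) \<partial>lborel)
        + (\<integral>\<^sup>+ Z. ennreal (?p (- \<nu>) \<nu>' Z) \<partial>lborel) + (\<integral>\<^sup>+ Z. ennreal (?p (- \<nu>) (- \<nu>') Z) \<partial>lborel))"
      by (simp add: nn_integral_cmult nn_integral_add)
    also have "\<dots> \<le> ennreal (D * K) * (ennreal (L * ?j \<nu> \<nu>') + ennreal (L * ?j \<nu> (- \<nu>'))
        + ennreal (L * ?j (- \<nu>) \<nu>') + ennreal (L * ?j (- \<nu>) (- \<nu>')))"
      by (intro mult_left_mono add_mono L(2)) simp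
    also have "\<dots> = ennreal (D * K * (L * ?j \<nu> \<nu>' + L * ?j \<nu> (- \<nu>') + L * ?j (- \<nu>) \<nu>' + L * ?j (- \<nu>) (- \<nu>')))"
      using D0 K(1) L(1) by (simp add: ennreal_mult)
    finally have "cmod (weyl_form T (psi alpha zeta k' l') (psi alpha zeta k l))
      \<le> D * K * (L * ?j \<nu> \<nu>' + L * ?j \<nu> (- \<nu>') + L * ?j (- \<nu>) \<nu>' + L * ?j (- \<nu>) (- \<nu>'))"
      using D0 K(1) L(1) by (subst (asm) ennreal_le_iff) auto
    \<comment> \<open>Reversing both signs only reflects the second coordinate, so the four terms
      agree in pairs; this is the factor 2 in the constant.\<close>
    also have "?j (- \<nu>) (- \<nu>') = ?j \<nu> \<nu>'"
      by (simp add: jb_def norm_Pair power2_commute)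
    also have "?j (- \<nu>) \<nu>' = ?j \<nu> (- \<nu>')"
    proof -
      have "- \<nu> - \<nu>' = - (\<nu> - (- \<nu>'))"
        by simp
      then show ?thesis
        by (simp only: jb_def norm_Pair norm_minus_cancel)
    qed
    also have "D * K * (L * ?j \<nu> \<nu>' + L * ?j \<nu> (- \<nu>') + L * ?j \<nu> (- \<nu>') + L * ?j \<nu> \<nu>')
      = D * K * L * 2 * (?j \<nu> \<nu>' + ?j \<nu> (- \<nu>'))"
      by (simp add: algebra_simps)
    also have "\<dots> \<le> D * K * L * 2 * (jb (d, (real l - real l') / (2 * alpha)) powr (- s)
              + jb (d, (real l + real l') / (2 * alpha)) powr (- s))"
    proof (intro mult_left_mono add_mono)
      have "\<nu> - \<nu>' = (real l - real l') / (2 * alpha)"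
        using alpha_pos by (simp add: \<nu>_def \<nu>'_def field_simps)
      then show "?j \<nu> \<nu>' \<le> jb (d, (real l - real l') / (2 * alpha)) powr (- s)"
        by simp
      \<comment> \<open>The sum of the frequencies exceeds (l + l') / (2 alpha) by 1 / (2 alpha).
        Both are nonnegative, so the excess enlarges the bracket and the negative power only
        improves.\<close>
      have "\<nu> - (- \<nu>') = (real l + real l' + 1) / (2 * alpha)"
        using alpha_pos by (simp add: \<nu>_def \<nu>'_def field_simps)
      then have "\<bar>(real l + real l') / (2 * alpha)\<bar> \<le> \<bar>\<nu> - (- \<nu>')\<bar>"
        using alpha_pos by (simp add: divide_right_mono)
      then have "norm (d, (real l + real l') / (2 * alpha)) \<le> norm (d, \<nu> - (- \<nu>'))"
        unfolding norm_Pair real_norm_def by (intro real_sqrt_le_mono add_left_mono power_mono) auto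
      then show "?j \<nu> (- \<nu>') \<le> jb (d, (real l + real l') / (2 * alpha)) powr (- s)"
        using s0 by (intro jb_powr_antimono) auto
    qed (use D0 K(1) L(1) in auto)
    finally show ?thesis
      unfolding d_def .
  qed
  then show ?thesis
    by blast
qed

end

theorem mainTheorem19:
  fixes alpha eps s :: real and N :: nat and zeta :: "real \<Rightarrow> real"
    and T :: "(real \<times> real \<Rightarrow> complex) \<Rightarrow> complex"
  assumes "alpha > 0" and "2 < s" and "s < real N"
    and "0 < eps" and "eps < alpha / 2"
    and "Ck (N - 1) zeta"
    and "\<forall>t. zeta (- t) = zeta t"
    and "\<forall>t. eps < \<bar>t\<bar> \<longrightarrow> zeta t = 0"
    and "integral UNIV zeta = pi / 2"
    and "\<exists>C. \<forall>z. cmod (stft1 (\<lambda>t. complex_of_real (bell alpha zeta t))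
                              (\<lambda>t. complex_of_real (bell alpha zeta t)) z)
               \<le> C * jb z powr (- real N)"
    and "in_Minf_weighted s T"
  shows "\<exists>Cs. \<forall>k k' :: int. \<forall>l l' :: nat.
     cmod (weyl_form T (psi alpha zeta k' l') (psi alpha zeta k l))
       \<le> Cs * (jb (alpha * of_int (k - k'), (real l - real l') / (2 * alpha)) powr (- s)
              + jb (alpha * of_int (k - k'), (real l + real l') / (2 * alpha)) powr (- s))"
proof -
  interpret bell_profile alpha eps zeta
    using assms by unfold_locales (auto intro: Ck_imp_continuous)
  obtain C where "\<And>z. cmod (stft1 cbell cbell z) \<le> C * jb z powr (- real N)"
    using assms(10) by blast
  moreover obtain D where "\<And>z \<zeta>. cmod (dstft T (z, \<zeta>)) * jb \<zeta> powr s \<le> D"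
    using assms(11) unfolding in_Minf_weighted_def by blast
  ultimately show ?thesis
    using weyl_form_psi_bound[OF assms(2,3)] by blast
qed

end
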